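(* There exist absolute constants $K,C>0$ such that the following holds. Let $p\in(0,1)$, let $n,d$ be integers with $1\le d\le K\sqrt{np(1-p)/\log[np(1-p)]}$, and let $k_1,\dots,k_{d+1}\in\{0,\dots,n\}$ be an $(\eta,M)$-system (with respect to $p$ and $n$) with $M\le\sqrt{np(1-p)}/(9d)$. Put $s=\sqrt{3\log[np(1-p)]}$, and for an integer $k$ write $\sigma(k)=\frac{k-np}{\sqrt{np(1-p)}}$. Then there exist real constants $\gamma_{k,i}$, for $1\le i\le d+1$ and for those integers $0\le k\le n$ with $|\sigma(k)|\le s$, satisfying $$|\gamma_{k,i}|\le\left(C(1+|\sigma(k)|)\frac M\eta\right)^d,$$ such that the following holds for every real multilinear polynomial $f$ in $x_1,\dots,x_n$ of degree $d$ with $\|f\|_{\nu_{k_i}}\le1$ for all $1\le i\le d+1$. Let $(\mathbf f_1,\dots,\mathbf f_{d+1})$ be the profile of $f$ with respect to $k_1,\dots,k_{d+1}$. Define a random variable $\mathbf f$ as follows: choose $k\sim\mathrm B(n,p)$ conditioned on $|\sigma(k)|\le s$, independently of the profile, and let $\mathbf f=\sum_{i=1}^{d+1}\gamma_{k,i}\mathbf f_i$. Then the Lévy distance between the distribution of $f$ under $\mu_p$ and the distribution of $\mathbf f$ is at most $$\left(C\,\frac{d}{p(1-p)}\cdot\frac M\eta\right)^{Cd}\frac1{\sqrt[8]{np(1-p)}}.$$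
   Context: A polynomial is multilinear if all its monomials are squarefree. For $0\le k\le n$, $\nu_k$ is the uniform probability measure on $\{x\in\{0,1\}^n:\sum_i x_i=k\}$; $\mu_p$ is the product measure on $\{0,1\}^n$ with $\mu_p(x)=p^{\sum x_i}(1-p)^{\sum(1-x_i)}$; $\|f\|_\alpha=\sqrt{\mathbb E_\alpha[f^2]}$. $\mathrm B(n,p)$ is the binomial distribution. Fix $p\in(0,1)$ and $n$. Integers $0\le k_1,\dots,k_r\le n$ form an $(\eta,M)$-system, where $0<\eta\le1$ and $M\ge1$, if with $\sigma_i=\frac{k_i-np}{\sqrt{np(1-p)}}$ one has $|\sigma_i-\sigma_j|\ge\eta$ for all $i\ne j$ and $|\sigma_i|\le M$ for all $i$. Coupling of the slices: let $\boldsymbol\pi$ be a uniformly random permutation of $\{1,\dots,n\}$, and for $0\le s\le n$ let $\mathbf X(s)\in\{0,1\}^n$ be the point with $\mathbf X(s)_i=1$ if $i\in\boldsymbol\pi(\{1,\dots,s\})$ and $\mathbf X(s)_i=0$ otherwise. The profile of $f$ with respect to $k_1,\dots,k_{d+1}$ is the joint distribution of $(\mathbf f_1,\dots,\mathbf f_{d+1}):=(f(\mathbf X(k_1)),\dots,f(\mathbf X(k_{d+1})))$. The Lévy distance between two real random variables $X,Y$ is the infimum of all $\epsilon$ such that for all $t\in\mathbb R$, $\Pr[X\le t-\epsilon]-\epsilon\le\Pr[Y\le t]\le\Pr[X\le t+\epsilon]+\epsilon$. *)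

theory Defs
  imports "HOL-Probability.Probability" "HOL-Library.Poly_Mapping"
begin

text \<open>
  A real polynomial in the variables \<open>x\<^sub>i\<close>, \<open>i :: nat\<close>, is a finitely supported map from monomials
  to coefficients; a monomial is a finitely supported map from variable indices to exponents.
\<close>

type_synonym real_mpoly = "(nat \<Rightarrow>\<^sub>0 nat) \<Rightarrow>\<^sub>0 real"

definition mpoly_eval :: "real_mpoly \<Rightarrow> (nat \<Rightarrow> real) \<Rightarrow> real" where
  "mpoly_eval f x =
     (\<Sum>m\<in>Poly_Mapping.keys f.
        Poly_Mapping.lookup f m * (\<Prod>i\<in>Poly_Mapping.keys m. x i ^ Poly_Mapping.lookup m i))"

definition in_variables :: "nat \<Rightarrow> real_mpoly \<Rightarrow> bool" where
  "in_variables n f \<longleftrightarrow> (\<forall>m\<in>Poly_Mapping.keys f. Poly_Mapping.keys m \<subseteq> {1..n})"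

definition multilinear :: "real_mpoly \<Rightarrow> bool" where
  "multilinear f \<longleftrightarrow> (\<forall>m\<in>Poly_Mapping.keys f. \<forall>i. Poly_Mapping.lookup m i \<le> 1)"

definition monomial_degree :: "(nat \<Rightarrow>\<^sub>0 nat) \<Rightarrow> nat" where
  "monomial_degree m = (\<Sum>i\<in>Poly_Mapping.keys m. Poly_Mapping.lookup m i)"

text \<open>The zero polynomial has degree \<open>0\<close>.\<close>

definition total_degree :: "real_mpoly \<Rightarrow> nat" where
  "total_degree f = Max (insert 0 (monomial_degree ` Poly_Mapping.keys f))"

text \<open>
  Points of \<open>{0,1}\<^sup>n\<close> are functions on \<open>nat\<close> with values in \<open>{0,1}\<close> on \<open>{1..n}\<close> and the
  (irrelevant) default value \<open>0\<close> elsewhere.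
\<close>

definition cube :: "nat \<Rightarrow> (nat \<Rightarrow> real) set" where
  "cube n = PiE_dflt {1..n} 0 (\<lambda>_. {0, 1})"

definition slice :: "nat \<Rightarrow> nat \<Rightarrow> (nat \<Rightarrow> real) set" where
  "slice n k = {x \<in> cube n. (\<Sum>i=1..n. x i) = real k}"

definition nu :: "nat \<Rightarrow> nat \<Rightarrow> (nat \<Rightarrow> real) pmf" where
  "nu n k = pmf_of_set (slice n k)"

definition mu :: "nat \<Rightarrow> real \<Rightarrow> (nat \<Rightarrow> real) pmf" where
  "mu n p = Pi_pmf {1..n} 0 (\<lambda>_. map_pmf of_bool (bernoulli_pmf p))"

lemma pmf_mu:
  assumes "0 < p" "p < 1" "x \<in> cube n"
  shows "pmf (mu n p) x = p powr (\<Sum>i=1..n. x i) * (1 - p) powr (\<Sum>i=1..n. 1 - x i)"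
proof -
  have inj: "inj (of_bool :: bool \<Rightarrow> real)"
    by (auto simp: inj_def)
  have p1: "pmf (map_pmf of_bool (bernoulli_pmf p)) (1::real) = p"
    using pmf_map_inj'[OF inj, of "bernoulli_pmf p" True] assms by simp
  have p0: "pmf (map_pmf of_bool (bernoulli_pmf p)) (0::real) = 1 - p"
    using pmf_map_inj'[OF inj, of "bernoulli_pmf p" False] assms by simp
  have "pmf (mu n p) x = (\<Prod>i=1..n. pmf (map_pmf of_bool (bernoulli_pmf p)) (x i))"
    using assms(3) unfolding mu_def by (subst pmf_Pi) (auto simp: cube_def PiE_dflt_def)
  also have "\<dots> = (\<Prod>i=1..n. p powr x i * (1 - p) powr (1 - x i))"
  proof (rule prod.cong)
    fix i assume "i \<in> {1..n}"
    hence "x i = 0 \<or> x i = 1" using assms(3) by (auto simp: cube_def PiE_dflt_def)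
    thus "pmf (map_pmf of_bool (bernoulli_pmf p)) (x i) = p powr x i * (1 - p) powr (1 - x i)"
      using assms p0 p1 by auto
  qed simp
  finally show ?thesis using assms by (simp add: prod.distrib powr_sum)
qed

definition L2_norm_under :: "(nat \<Rightarrow> real) pmf \<Rightarrow> real_mpoly \<Rightarrow> real" where
  "L2_norm_under \<alpha> f = sqrt (measure_pmf.expectation \<alpha> (\<lambda>x. (mpoly_eval f x)\<^sup>2))"

definition sigma_of :: "real \<Rightarrow> nat \<Rightarrow> nat \<Rightarrow> real" where
  "sigma_of p n k = (real k - real n * p) / sqrt (real n * p * (1 - p))"

definition eta_M_system ::
  "real \<Rightarrow> nat \<Rightarrow> nat \<Rightarrow> (nat \<Rightarrow> nat) \<Rightarrow> real \<Rightarrow> real \<Rightarrow> bool" where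
  "eta_M_system p n r k \<eta> M \<longleftrightarrow>
     0 < \<eta> \<and> \<eta> \<le> 1 \<and> 1 \<le> M \<and>
     (\<forall>i\<in>{1..r}. k i \<le> n) \<and>
     (\<forall>i\<in>{1..r}. \<forall>j\<in>{1..r}. i \<noteq> j \<longrightarrow> \<bar>sigma_of p n (k i) - sigma_of p n (k j)\<bar> \<ge> \<eta>) \<and>
     (\<forall>i\<in>{1..r}. \<bar>sigma_of p n (k i)\<bar> \<le> M)"

definition slice_point :: "(nat \<Rightarrow> nat) \<Rightarrow> nat \<Rightarrow> nat \<Rightarrow> real" where
  "slice_point \<pi> s = (\<lambda>i. if i \<in> \<pi> ` {1..s} then 1 else 0)"

text \<open>
  The joint distribution of a vector indexed by \<open>{1..r}\<close>, encoded as a function that is \<open>0\<close>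
  outside of \<open>{1..r}\<close>.
\<close>

definition profile :: "nat \<Rightarrow> real_mpoly \<Rightarrow> nat \<Rightarrow> (nat \<Rightarrow> nat) \<Rightarrow> (nat \<Rightarrow> real) pmf" where
  "profile n f r k =
     map_pmf (\<lambda>\<pi> i. if i \<in> {1..r} then mpoly_eval f (slice_point \<pi> (k i)) else 0)
       (pmf_of_set {\<pi>. \<pi> permutes {1..n}})"

text \<open>
  No condition \<open>\<epsilon> \<ge> 0\<close> is needed below: letting \<open>t\<close> tend to infinity shows that negative \<open>\<epsilon>\<close> never
  qualify for probability measures.
\<close>

definition levy_distance :: "real measure \<Rightarrow> real measure \<Rightarrow> real" where
  "levy_distance X Y =
     Inf {\<epsilon>. \<forall>t. cdf X (t - \<epsilon>) - \<epsilon> \<le> cdf Y t \<and> cdf Y t \<le> cdf X (t + \<epsilon>) + \<epsilon>}"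

text \<open>
  \<open>conditioned_binomial p n s\<close> is \<open>B(n,p)\<close> conditioned on \<open>\<bar>\<sigma>(k)\<bar> \<le> s\<close>; as always with
  \<open>cond_pmf\<close>, it is only meaningful if this event has positive probability.
\<close>

definition conditioned_binomial :: "real \<Rightarrow> nat \<Rightarrow> real \<Rightarrow> nat pmf" where
  "conditioned_binomial p n s = cond_pmf (binomial_pmf n p) {k. \<bar>sigma_of p n k\<bar> \<le> s}"

text \<open>The product distribution \<open>pair_pmf\<close> makes \<open>k\<close> independent of the profile.\<close>

definition mixed_profile ::
  "real \<Rightarrow> nat \<Rightarrow> real \<Rightarrow> (nat \<Rightarrow> nat \<Rightarrow> real) \<Rightarrow> nat \<Rightarrow> (nat \<Rightarrow> real) pmf \<Rightarrow> real pmf" where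
  "mixed_profile p n s \<gamma> r P =
     map_pmf (\<lambda>(k, y). \<Sum>i=1..r. \<gamma> k i * y i) (pair_pmf (conditioned_binomial p n s) P)"

end

theory Submission
  imports Defs
begin

text \<open>
  A point of the slice of weight \<open>k\<close> is a set \<open>X\<close> of size \<open>k\<close>, and the coupling of the slices is the
  chain \<open>X\<^sub>k = \<pi> ` {1..k}\<close> for a uniformly random permutation \<open>\<pi>\<close>. Call a function \<open>h\<close> of sets
  harmonic of degree \<open>j\<close> if its one-step averages along the chain, downwards and upwards from \<open>X\<^sub>k\<close>, are
  the multiples \<open>1 - j / k\<close> and \<open>1 - j / (n - k)\<close> of \<open>h\<close> itself. Along the chain such a function is then, up
  to explicit scalars close to \<open>1\<close>, a martingale in both directions, so that \<open>h(X\<^sub>k)\<close> and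
  \<open>h(X\<^sub>l)\<close> are close in \<open>L\<^sup>2\<close> as long as \<open>j \<bar>k - l\<bar>\<close> is small compared with
  \<open>N = n p (1 - p)\<close> (\<open>harmonic_stable\<close>).

  A multilinear polynomial \<open>f\<close> of degree \<open>d\<close> need not be harmonic, but on sets it is a sum of
  products of a harmonic function with a polynomial of degree at most \<open>d\<close> in the size of the set
  (\<open>ex_harmonic_expansion\<close>). So on the slice of weight \<open>l\<close> it agrees with a harmonic function
  \<open>f\<^sub>l\<close> whose dependence on \<open>l\<close> is polynomial of degree at most \<open>d\<close>. Lagrange interpolation writes
  \<open>f\<^sub>l\<close> as \<open>\<Sum>\<^sub>i \<gamma>\<^sub>l\<^sub>,\<^sub>i f\<^bsub>k\<^sub>i\<^esub>\<close>, where the nodes are the \<open>d + 1\<close> given slices, and the separation of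
  the slices bounds \<open>\<gamma>\<^sub>l\<^sub>,\<^sub>i\<close>. Harmonic parts of different degrees are orthogonal on all slices
  but the extreme ones (\<open>harmonic_orthogonal\<close>), so \<open>\<parallel>f\<parallel> \<le> 1\<close> on the slice of weight \<open>k\<^sub>i\<close> bounds all harmonic
  parts of \<open>f\<^bsub>k\<^sub>i\<^esub>\<close>. Replacing \<open>f\<^bsub>k\<^sub>i\<^esub>(X\<^sub>l)\<close> by \<open>f\<^bsub>k\<^sub>i\<^esub>(X\<^bsub>k\<^sub>i\<^esub>) = f(X\<^bsub>k\<^sub>i\<^esub>)\<close> therefore costs
  little in \<open>L\<^sup>2\<close>: this is \<open>interpolation_error\<close>, which compares \<open>f(X\<^sub>l)\<close> with
  \<open>\<Sum>\<^sub>i \<gamma>\<^sub>l\<^sub>,\<^sub>i f(X\<^bsub>k\<^sub>i\<^esub>)\<close>.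

  Finally \<open>\<mu>\<^sub>p\<close> is the law of \<open>X\<^sub>l\<close> for a binomial weight \<open>l\<close>. Conditioning on \<open>\<bar>\<sigma>(l)\<bar> \<le> s\<close>
  changes probabilities by at most \<open>2 N\<^bsup>-3/4\<^esup>\<close> (\<open>binomial_tail\<close>), and an \<open>L\<^sup>2\<close>
  bound turns into a bound on the Levy distance by Chebyshev's inequality
  (\<open>levy_distance_conditioned_le\<close>). The squared \<open>L\<^sup>2\<close> error is of order \<open>N\<^bsup>-1/2\<^esup>\<close> up to powers of
  \<open>d\<close> and \<open>M / \<eta>\<close> and a factor \<open>(ln N)\<^bsup>O(d)\<^esup>\<close>. The latter is absorbed by \<open>d\<^bsup>O(d)\<^esup> N\<^bsup>1/8\<^esup>\<close> (\<open>log_power_absorbed\<close>), and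
  the cube root of the remaining \<open>N\<^bsup>-3/8\<^esup>\<close> is the eighth root in the theorem.
\<close>

section \<open>Harmonic functions on the slices\<close>

(* Indicator sums have to keep their shape for interchanges of summation. *)
declare sum_of_bool_eq [simp del] sum_mult_of_bool_eq [simp del] sum_of_bool_mult_eq [simp del]

text \<open>
  The two identities say that averaging \<open>h\<close> over the neighbours of \<open>X\<close> one slice below, or one slice
  above, multiplies \<open>h X\<close> by a scalar that depends on the slice only. For a homogeneous polynomial of degree
  \<open>j\<close> the first is Euler's identity, and the second amounts to the vanishing of the sum of the partial
  derivatives, which is the usual definition of harmonicity.
\<close>

definition harmonic :: "nat \<Rightarrow> nat \<Rightarrow> (nat set \<Rightarrow> real) \<Rightarrow> bool" where
  "harmonic n j h \<longleftrightarrow> (\<forall>X\<subseteq>{1..n}.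
     (\<Sum>i\<in>X. h (X - {i})) = (real (card X) - real j) * h X \<and>
     (\<Sum>i\<in>{1..n} - X. h (insert i X)) = (real n - real (card X) - real j) * h X)"

lemma harmonic_sum:
  assumes "\<And>m. m \<in> I \<Longrightarrow> harmonic n j (h m)"
  shows "harmonic n j (\<lambda>X. \<Sum>m\<in>I. a m * h m X)"
  unfolding harmonic_def
proof (intro allI impI conjI)
  fix X :: "nat set" assume X: "X \<subseteq> {1..n}"
  have "(\<Sum>i\<in>X. \<Sum>m\<in>I. a m * h m (X - {i})) = (\<Sum>m\<in>I. a m * (\<Sum>i\<in>X. h m (X - {i})))"
    by (subst sum.swap) (simp add: sum_distrib_left)
  also have "\<dots> = (\<Sum>m\<in>I. (real (card X) - real j) * (a m * h m X))"
    using assms X by (intro sum.cong) (auto simp: harmonic_def)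
  finally show "(\<Sum>i\<in>X. \<Sum>m\<in>I. a m * h m (X - {i})) = (real (card X) - real j) * (\<Sum>m\<in>I. a m * h m X)"
    by (simp add: sum_distrib_left)
  have "(\<Sum>i\<in>{1..n}-X. \<Sum>m\<in>I. a m * h m (insert i X)) = (\<Sum>m\<in>I. a m * (\<Sum>i\<in>{1..n}-X. h m (insert i X)))"
    by (subst sum.swap) (simp add: sum_distrib_left)
  also have "\<dots> = (\<Sum>m\<in>I. (real n - real (card X) - real j) * (a m * h m X))"
    using assms X by (intro sum.cong) (auto simp: harmonic_def)
  finally show "(\<Sum>i\<in>{1..n}-X. \<Sum>m\<in>I. a m * h m (insert i X)) = (real n - real (card X) - real j) * (\<Sum>m\<in>I. a m * h m X)"
    by (simp add: sum_distrib_left)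
qed

lemma harmonic_scale:
  assumes "harmonic n j h"
  shows "harmonic n j (\<lambda>X. c * h X)"
  using harmonic_sum[of "{()}" n j "\<lambda>_. h" "\<lambda>_. c"] assms by simp

text \<open>
  Orthogonal projection onto a finite-dimensional span, in the form of Gram-Schmidt: the new vector is
  made orthogonal to the old ones first. If the residual of the new vector vanishes, the quotient below
  is \<open>0\<close>, which is a correct coefficient.
\<close>

lemma orthogonal_residual_exists:
  fixes v :: "'b \<Rightarrow> 'a \<Rightarrow> real" and f :: "'a \<Rightarrow> real"
  assumes "finite A" "finite B"
  shows "\<exists>g. \<forall>b\<in>B. (\<Sum>a\<in>A. (f a - (\<Sum>b\<in>B. g b * v b a)) * v b a) = 0"
  using assms(2)
proof (induction B arbitrary: f rule: finite_induct)
  case empty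
  show ?case by simp
next
  case (insert b B)
  obtain u where u: "\<forall>c\<in>B. (\<Sum>a\<in>A. (v b a - (\<Sum>c\<in>B. u c * v c a)) * v c a) = 0"
    using insert.IH by blast
  obtain w where w: "\<forall>c\<in>B. (\<Sum>a\<in>A. (f a - (\<Sum>c\<in>B. w c * v c a)) * v c a) = 0"
    using insert.IH by blast
  define r where "r a = v b a - (\<Sum>c\<in>B. u c * v c a)" for a
  define r' where "r' a = f a - (\<Sum>c\<in>B. w c * v c a)" for a
  define t where "t = (\<Sum>a\<in>A. r' a * r a) / (\<Sum>a\<in>A. r a * r a)"
  define g where "g c = (if c = b then t else w c - t * u c)" for c
  \<comment> \<open>The residual of \<open>f\<close> with respect to \<open>B\<close> is corrected along the residual of \<open>v b\<close>.\<close>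
  have res: "f a - (\<Sum>c\<in>insert b B. g c * v c a) = r' a - t * r a" for a
  proof -
    have "(\<Sum>c\<in>insert b B. g c * v c a) = t * v b a + (\<Sum>c\<in>B. g c * v c a)"
      using insert.hyps by (simp add: g_def)
    also have "(\<Sum>c\<in>B. g c * v c a) = (\<Sum>c\<in>B. w c * v c a - t * (u c * v c a))"
      using insert.hyps by (intro sum.cong) (auto simp: g_def algebra_simps)
    also have "\<dots> = (\<Sum>c\<in>B. w c * v c a) - t * (\<Sum>c\<in>B. u c * v c a)"
      by (simp add: sum_subtractf sum_distrib_left)
    finally show ?thesis by (simp add: r_def r'_def algebra_simps)
  qed
  have orth_B: "(\<Sum>a\<in>A. (r' a - t * r a) * v c a) = 0" if "c \<in> B" for c
  proof -
    have "(\<Sum>a\<in>A. (r' a - t * r a) * v c a) =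
      (\<Sum>a\<in>A. r' a * v c a) - t * (\<Sum>a\<in>A. r a * v c a)"
      by (simp add: sum_subtractf sum_distrib_left algebra_simps)
    thus ?thesis using u w that by (simp add: r_def r'_def)
  qed
  have orth_r: "(\<Sum>a\<in>A. (r' a - t * r a) * r a) = 0"
  proof (cases "(\<Sum>a\<in>A. r a * r a) = 0")
    case True
    hence "\<forall>a\<in>A. r a = 0"
      using assms(1) by (simp add: sum_nonneg_eq_0_iff)
    thus ?thesis by simp
  next
    case False
    have "(\<Sum>a\<in>A. (r' a - t * r a) * r a) = (\<Sum>a\<in>A. r' a * r a) - t * (\<Sum>a\<in>A. r a * r a)"
      by (simp add: sum_subtractf sum_distrib_left algebra_simps)
    thus ?thesis using False by (simp add: t_def)
  qed
  have vb: "v b a = r a + (\<Sum>c\<in>B. u c * v c a)" for a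
    by (simp add: r_def)
  have "(\<Sum>a\<in>A. (r' a - t * r a) * v b a) =
     (\<Sum>a\<in>A. (r' a - t * r a) * r a) + (\<Sum>a\<in>A. \<Sum>c\<in>B. u c * ((r' a - t * r a) * v c a))"
    by (simp only: vb distrib_left sum.distrib sum_distrib_left mult.left_commute)
  also have "(\<Sum>a\<in>A. \<Sum>c\<in>B. u c * ((r' a - t * r a) * v c a)) =
     (\<Sum>c\<in>B. u c * (\<Sum>a\<in>A. (r' a - t * r a) * v c a))"
    by (subst sum.swap) (simp add: sum_distrib_left)
  finally have orth_b: "(\<Sum>a\<in>A. (r' a - t * r a) * v b a) = 0"
    using orth_r orth_B by simp
  show ?case
    by (rule exI[of _ g]) (use orth_b orth_B in \<open>simp only: res, auto\<close>)
qed

definition subsets_of_size :: "nat \<Rightarrow> nat \<Rightarrow> nat set set" where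
  "subsets_of_size n j = {A. A \<subseteq> {1..n} \<and> card A = j}"

lemma finite_subsets_of_size [simp]: "finite (subsets_of_size n j)"
  by (rule finite_subset[of _ "Pow {1..n}"]) (auto simp: subsets_of_size_def)

definition homogeneous :: "nat \<Rightarrow> nat \<Rightarrow> (nat set \<Rightarrow> real) \<Rightarrow> nat set \<Rightarrow> real" where
  "homogeneous n j c X = (\<Sum>A\<in>subsets_of_size n j. c A * of_bool (A \<subseteq> X))"

lemma homogeneous_down:
  assumes "X \<subseteq> {1..n}"
  shows "(\<Sum>i\<in>X. homogeneous n j c (X - {i})) = (real (card X) - real j) * homogeneous n j c X"
proof -
  have fX: "finite X" using assms finite_subset by blast
  have count: "(\<Sum>i\<in>X. of_bool (A \<subseteq> X - {i})) = (real (card X) - real j) * of_bool (A \<subseteq> X)"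
    if "A \<in> subsets_of_size n j" for A
  proof (cases "A \<subseteq> X")
    case True
    have "(\<Sum>i\<in>X. of_bool (A \<subseteq> X - {i}) :: real) = (\<Sum>i\<in>X - A. 1)"
      using True fX by (intro sum.mono_neutral_cong_right) auto
    also have "\<dots> = real (card X) - real j"
      using True that fX finite_subset[OF True fX] card_mono[OF fX True]
      by (simp add: subsets_of_size_def card_Diff_subset of_nat_diff)
    finally show ?thesis using True by simp
  next
    case False
    hence "\<not> A \<subseteq> X - {i}" for i by auto
    thus ?thesis using False by simp
  qed
  have "(\<Sum>i\<in>X. homogeneous n j c (X - {i})) =
     (\<Sum>A\<in>subsets_of_size n j. c A * (\<Sum>i\<in>X. of_bool (A \<subseteq> X - {i})))"
    unfolding homogeneous_def by (subst sum.swap) (simp add: sum_distrib_left)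
  also have "\<dots> = (\<Sum>A\<in>subsets_of_size n j. (real (card X) - real j) * (c A * of_bool (A \<subseteq> X)))"
    by (intro sum.cong refl) (simp only: count mult.left_commute)
  finally show ?thesis by (simp add: homogeneous_def sum_distrib_left)
qed

text \<open>
  The hypothesis says that \<open>c\<close> is orthogonal to every \<open>\<lambda>A. of_bool (B \<subseteq> A)\<close> with \<open>card B = j\<close>.
  Adding up these relations over all \<open>B \<subseteq> X\<close> weights each \<open>A\<close> by the number of \<open>B \<subseteq> A \<inter> X\<close>:
  this is \<open>j + 1\<close> if \<open>A \<subseteq> X\<close>, it is \<open>1\<close> if exactly one element of \<open>A\<close> is outside \<open>X\<close>, and \<open>0\<close> otherwise.
  The middle case counts the sets that become contained after the insertion of a point.
\<close>

lemma homogeneous_up: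
  assumes X: "X \<subseteq> {1..n}"
    and c: "\<And>B. B \<in> subsets_of_size n j \<Longrightarrow>
      (\<Sum>A\<in>subsets_of_size n (Suc j). c A * of_bool (B \<subseteq> A)) = 0"
  shows "(\<Sum>i\<in>{1..n} - X. homogeneous n (Suc j) c (insert i X)) =
    (real n - real (card X) - real (Suc j)) * homogeneous n (Suc j) c X"
proof -
  let ?S = "subsets_of_size n (Suc j)"
  have fX: "finite X" using X finite_subset by blast
  have cX: "card X \<le> n" using card_mono[OF _ X] by simp
  have count: "(\<Sum>i\<in>{1..n}-X. of_bool (A \<subseteq> insert i X)) =
      (real n - real (card X) - real (Suc j)) * of_bool (A \<subseteq> X)
        + (\<Sum>B\<in>{B. B \<subseteq> X \<and> card B = j}. of_bool (B \<subseteq> A))"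
    if A: "A \<in> ?S" for A
  proof -
    have fA: "finite A" and cA: "card A = Suc j" and AN: "A \<subseteq> {1..n}"
      using A finite_subset by (auto simp: subsets_of_size_def)
    have "(\<Sum>B\<in>{B. B \<subseteq> X \<and> card B = j}. of_bool (B \<subseteq> A) :: real) =
          (\<Sum>B\<in>{B. B \<subseteq> A \<inter> X \<and> card B = j}. 1)"
      using fX by (intro sum.mono_neutral_cong_right) auto
    also have "\<dots> = real (card (A \<inter> X) choose j)"
      using fX n_subsets[of "A \<inter> X" j] by simp
    finally have B: "(\<Sum>B\<in>{B. B \<subseteq> X \<and> card B = j}. of_bool (B \<subseteq> A) :: real) = real (card (A \<inter> X) choose j)" .
    show ?thesis
    proof (cases "A \<subseteq> X")
      case True
      hence "A \<inter> X = A" by auto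
      moreover have "(\<Sum>i\<in>{1..n}-X. of_bool (A \<subseteq> insert i X)) = (\<Sum>i\<in>{1..n}-X. 1::real)"
        using True by (intro sum.cong) auto
      ultimately show ?thesis using True B cA X fX cX
        by (simp add: card_Diff_subset of_nat_diff)
    next
      case False
      show ?thesis
      proof (cases "\<exists>i. A - X = {i}")
        case True
        then obtain i where i: "A - X = {i}" by blast
        have "(\<Sum>m\<in>{1..n}-X. of_bool (A \<subseteq> insert m X)) = (\<Sum>m\<in>{i}. 1::real)"
          using i AN by (intro sum.mono_neutral_cong_right) auto
        moreover have "card (A \<inter> X) = j"
          using card_Diff_subset_Int[of A X] fA fX i cA card_mono[of A "A \<inter> X"] by (simp add: Int_commute)
        ultimately show ?thesis using False B by simp
      next
        case nosing: False
        have "\<not> A \<subseteq> insert m X" for m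
          using nosing False by blast
        moreover have "card (A \<inter> X) < j"
        proof -
          have "card (A - X) \<noteq> 0" using False fA by auto
          moreover have "card (A - X) \<noteq> 1" using nosing by (auto simp: card_1_singleton_iff)
          moreover have "card A = card (A \<inter> X) + card (A - X)"
            using fA by (metis card_Int_Diff)
          ultimately show ?thesis using cA by linarith
        qed
        ultimately show ?thesis using False B by simp
      qed
    qed
  qed
  have "(\<Sum>i\<in>{1..n} - X. homogeneous n (Suc j) c (insert i X)) =
     (\<Sum>A\<in>?S. c A * (\<Sum>i\<in>{1..n}-X. of_bool (A \<subseteq> insert i X)))"
    unfolding homogeneous_def by (subst sum.swap) (simp add: sum_distrib_left)
  also have "\<dots> = (\<Sum>A\<in>?S. (real n - real (card X) - real (Suc j)) * (c A * of_bool (A \<subseteq> X))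
      + (\<Sum>B\<in>{B. B \<subseteq> X \<and> card B = j}. c A * of_bool (B \<subseteq> A)))"
    by (intro sum.cong refl) (simp only: count sum_distrib_left distrib_left mult.left_commute)
  also have "\<dots> = (real n - real (card X) - real (Suc j)) * homogeneous n (Suc j) c X +
      (\<Sum>B\<in>{B. B \<subseteq> X \<and> card B = j}. \<Sum>A\<in>?S. c A * of_bool (B \<subseteq> A))"
    by (subst sum.swap[of _ ?S]) (simp add: homogeneous_def sum.distrib sum_distrib_left)
  also have "(\<Sum>B\<in>{B. B \<subseteq> X \<and> card B = j}. \<Sum>A\<in>?S. c A * of_bool (B \<subseteq> A)) = 0"
    using X by (intro sum.neutral ballI c) (auto simp: subsets_of_size_def)
  finally show ?thesis by simp
qed

lemma homogeneous_zero_degree: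
  "homogeneous n 0 c X = c {}"
proof -
  have "subsets_of_size n 0 = {{}}"
    by (auto simp: subsets_of_size_def dest: finite_subset)
  thus ?thesis by (simp add: homogeneous_def)
qed

text \<open>
  Multiplication by \<open>\<Sum>\<^sub>i x\<^sub>i - j\<close> maps homogeneous polynomials of degree \<open>j\<close> to those of degree
  \<open>j + 1\<close> on the cube, and its adjoint is the sum of the partial derivatives. Hence the orthogonal
  complement of its image consists of harmonic polynomials.
\<close>

lemma homogeneous_step:
  "\<exists>h g. harmonic n (Suc j) h \<and>
     (\<forall>X\<subseteq>{1..n}. homogeneous n (Suc j) c X = h X + (real (card X) - real j) * homogeneous n j g X)"
proof -
  let ?S = "subsets_of_size n (Suc j)" and ?T = "subsets_of_size n j"
  obtain g where g: "\<forall>B\<in>?T. (\<Sum>A\<in>?S. (c A - (\<Sum>B\<in>?T. g B * of_bool (B \<subseteq> A))) * of_bool (B \<subseteq> A)) = 0"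
    using orthogonal_residual_exists[of ?S ?T c "\<lambda>B A. of_bool (B \<subseteq> A)"] by auto
  define r where "r A = c A - (\<Sum>B\<in>?T. g B * of_bool (B \<subseteq> A))" for A
  have harm: "harmonic n (Suc j) (homogeneous n (Suc j) r)"
    unfolding harmonic_def using g
    by (intro allI impI conjI homogeneous_down homogeneous_up) (auto simp: r_def)
  have "homogeneous n (Suc j) c X = homogeneous n (Suc j) r X + (real (card X) - real j) * homogeneous n j g X"
    if X: "X \<subseteq> {1..n}" for X
  proof -
    have fX: "finite X" using X finite_subset by blast
    have count: "(\<Sum>A\<in>?S. of_bool (B \<subseteq> A) * of_bool (A \<subseteq> X)) = (real (card X) - real j) * of_bool (B \<subseteq> X)"
      if B: "B \<in> ?T" for B
    proof (cases "B \<subseteq> X")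
      case True
      have fB: "finite B" using True fX finite_subset by blast
      have cB: "card B = j" using B by (simp add: subsets_of_size_def)
      have *: "\<exists>i\<in>X - B. A = insert i B" if "A \<in> ?S" "B \<subseteq> A" "A \<subseteq> X" for A
      proof -
        have "finite A" using that fX finite_subset by blast
        hence "card (A - B) = 1" using that cB fB by (simp add: subsets_of_size_def card_Diff_subset)
        then obtain i where "A - B = {i}" by (auto simp: card_1_singleton_iff)
        thus ?thesis using that by (intro bexI[of _ i]) auto
      qed
      have "(\<Sum>A\<in>?S. of_bool (B \<subseteq> A) * of_bool (A \<subseteq> X) :: real) = (\<Sum>A\<in>(\<lambda>i. insert i B) ` (X - B). 1)"
      proof (rule sum.mono_neutral_cong_right)
        show "(\<lambda>i. insert i B) ` (X - B) \<subseteq> ?S"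
          using True X fB cB by (auto simp: subsets_of_size_def)
        show "\<forall>A\<in>?S - (\<lambda>i. insert i B) ` (X - B). of_bool (B \<subseteq> A) * of_bool (A \<subseteq> X) = (0::real)"
          using * by auto
      qed (use True in auto)
      also have "\<dots> = real (card (X - B))"
        by (subst sum.reindex) (auto simp: inj_on_def)
      also have "\<dots> = real (card X) - real j"
        using True fB cB card_mono[OF fX True] by (simp add: card_Diff_subset of_nat_diff)
      finally show ?thesis using True by simp
    next
      case False
      hence "of_bool (B \<subseteq> A) * of_bool (A \<subseteq> X) = (0::real)" for A by auto
      thus ?thesis using False by (simp only:) simp
    qed
    have "homogeneous n (Suc j) c X - homogeneous n (Suc j) r X =
        (\<Sum>A\<in>?S. \<Sum>B\<in>?T. g B * (of_bool (B \<subseteq> A) * of_bool (A \<subseteq> X)))"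
      by (simp add: homogeneous_def r_def sum_subtractf[symmetric] left_diff_distrib sum_distrib_right mult.assoc)
    also have "\<dots> = (\<Sum>B\<in>?T. g B * (\<Sum>A\<in>?S. of_bool (B \<subseteq> A) * of_bool (A \<subseteq> X)))"
      by (subst sum.swap) (simp add: sum_distrib_left)
    also have "\<dots> = (\<Sum>B\<in>?T. (real (card X) - real j) * (g B * of_bool (B \<subseteq> X)))"
      by (intro sum.cong refl) (simp only: count mult.left_commute)
    finally show ?thesis by (simp add: homogeneous_def sum_distrib_left)
  qed
  with harm show ?thesis by blast
qed

text \<open>
  The argument \<open>t\<close> of \<open>F j t\<close> stands for the size of the set. Separating it from the set itself makes
  every \<open>F j t\<close> harmonic, and a polynomial in \<open>t\<close> that can be interpolated.
\<close>

definition harmonic_expansion :: "nat \<Rightarrow> nat \<Rightarrow> (nat set \<Rightarrow> real) \<Rightarrow> (nat \<Rightarrow> real \<Rightarrow> nat set \<Rightarrow> real) \<Rightarrow> bool" where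
  "harmonic_expansion n d \<phi> F \<longleftrightarrow>
     (\<forall>j t. harmonic n j (F j t)) \<and>
     (\<forall>j X. \<exists>q. degree q \<le> d \<and> (\<forall>t. F j t X = poly q t)) \<and>
     (\<forall>X\<subseteq>{1..n}. \<phi> X = (\<Sum>j\<le>d. F j (real (card X)) X))"

lemma homogeneous_expansion:
  assumes "e \<le> d"
  shows "\<exists>F. harmonic_expansion n d (homogeneous n e c) F"
proof -
  have "\<exists>F. harmonic_expansion n e (homogeneous n e c) F \<and> (\<forall>j>e. \<forall>t X. F j t X = 0)"
  proof (induction e arbitrary: c)
    case 0
    define F where "F j t X = (if j = 0 then homogeneous n 0 c X else 0)" for j :: nat and t :: real and X
    have "harmonic n j (F j t)" for j t
    proof (cases "j = 0")
      case True
      have "real (card ({1..n} - X)) = real n - real (card X)" if "X \<subseteq> {1..n}" for X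
        using that card_mono[OF _ that] finite_subset[OF that]
        by (simp add: card_Diff_subset of_nat_diff)
      thus ?thesis using True
        by (simp add: F_def harmonic_def homogeneous_zero_degree)
    qed (simp add: F_def harmonic_def)
    hence "harmonic_expansion n 0 (homogeneous n 0 c) F"
      by (auto simp: harmonic_expansion_def F_def intro!: exI[of _ "[:_:]"])
    moreover have "\<forall>j>0. \<forall>t X. F j t X = 0" by (simp add: F_def)
    ultimately show ?case by blast
  next
    case (Suc e)
    obtain h g where h: "harmonic n (Suc e) h"
      and hg: "\<And>X. X \<subseteq> {1..n} \<Longrightarrow> homogeneous n (Suc e) c X = h X + (real (card X) - real e) * homogeneous n e g X"
      using homogeneous_step by metis
    obtain F where F: "harmonic_expansion n e (homogeneous n e g) F" and F0: "\<And>j t X. j > e \<Longrightarrow> F j t X = 0"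
      using Suc.IH by blast
    define G where "G j t X = (if j = Suc e then h X else (t - real e) * F j t X)" for j t X
    have "harmonic n j (G j t)" for j t
      using h harmonic_scale[of n j "F j t"] F
      by (cases "j = Suc e") (auto simp: G_def[abs_def] harmonic_expansion_def)
    moreover have "\<exists>q. degree q \<le> Suc e \<and> (\<forall>t. G j t X = poly q t)" for j X
    proof (cases "j = Suc e")
      case True
      thus ?thesis by (intro exI[of _ "[:h X:]"]) (auto simp: G_def)
    next
      case False
      obtain q where q: "degree q \<le> e" "\<And>t. F j t X = poly q t"
        using F unfolding harmonic_expansion_def by blast
      have "degree ([:-real e, 1:] * q) \<le> Suc e"
        using degree_mult_le[of "[:-real e, 1:]" q] q(1) by simp
      thus ?thesis using q False by (intro exI[of _ "[:-real e, 1:] * q"]) (auto simp: G_def algebra_simps)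
    qed
    moreover have "homogeneous n (Suc e) c X = (\<Sum>j\<le>Suc e. G j (real (card X)) X)" if "X \<subseteq> {1..n}" for X
      using that F hg[OF that] by (simp add: G_def harmonic_expansion_def sum_distrib_left)
    moreover have "\<forall>j>Suc e. \<forall>t X. G j t X = 0"
      by (auto simp: G_def F0)
    ultimately show ?case unfolding harmonic_expansion_def by (intro exI[of _ G]) auto
  qed
  then obtain F where F: "harmonic_expansion n e (homogeneous n e c) F" and F0: "\<And>j t X. j > e \<Longrightarrow> F j t X = 0"
    by blast
  have "(\<Sum>j\<le>d. F j t X) = (\<Sum>j\<le>e. F j t X)" for t X
    using assms F0 by (intro sum.mono_neutral_right) auto
  thus ?thesis using F assms unfolding harmonic_expansion_def by (metis le_trans)
qed

lemma harmonic_expansion_sum: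
  assumes "\<And>m. m \<in> I \<Longrightarrow> harmonic_expansion n d (\<phi> m) (F m)"
  shows "harmonic_expansion n d (\<lambda>X. \<Sum>m\<in>I. a m * \<phi> m X) (\<lambda>j t X. \<Sum>m\<in>I. a m * F m j t X)"
  unfolding harmonic_expansion_def
proof (intro conjI allI impI)
  show "harmonic n j (\<lambda>X. \<Sum>m\<in>I. a m * F m j t X)" for j t
    using assms by (intro harmonic_sum) (auto simp: harmonic_expansion_def)
next
  fix j X
  have "\<forall>m\<in>I. \<exists>q. degree q \<le> d \<and> (\<forall>t. F m j t X = poly q t)"
    using assms by (auto simp: harmonic_expansion_def)
  then obtain q where q: "\<And>m. m \<in> I \<Longrightarrow> degree (q m) \<le> d" "\<And>m t. m \<in> I \<Longrightarrow> F m j t X = poly (q m) t"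
    by metis
  show "\<exists>q. degree q \<le> d \<and> (\<forall>t. (\<Sum>m\<in>I. a m * F m j t X) = poly q t)"
  proof (intro exI conjI allI)
    show "degree (\<Sum>m\<in>I. smult (a m) (q m)) \<le> d"
      by (cases "finite I") (auto intro!: degree_sum_le order_trans[OF degree_smult_le] q)
    show "(\<Sum>m\<in>I. a m * F m j t X) = poly (\<Sum>m\<in>I. smult (a m) (q m)) t" for t
      by (simp add: poly_sum q)
  qed
next
  fix X :: "nat set" assume "X \<subseteq> {1..n}"
  hence "(\<Sum>m\<in>I. a m * \<phi> m X) = (\<Sum>m\<in>I. \<Sum>j\<le>d. a m * F m j (real (card X)) X)"
    using assms by (intro sum.cong) (auto simp: harmonic_expansion_def sum_distrib_left)
  thus "(\<Sum>m\<in>I. a m * \<phi> m X) = (\<Sum>j\<le>d. \<Sum>m\<in>I. a m * F m j (real (card X)) X)"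
    by (subst sum.swap)
qed

lemma card_subsets_of_size: "card (subsets_of_size n k) = n choose k"
  using n_subsets[of "{1..n}" k] by (simp add: subsets_of_size_def)

definition indicator_point :: "nat set \<Rightarrow> nat \<Rightarrow> real" where
  "indicator_point A i = (if i \<in> A then 1 else 0)"

lemma slice_point_eq: "slice_point \<pi> k = indicator_point (\<pi> ` {1..k})"
  by (auto simp: slice_point_def indicator_point_def)

lemma inj_indicator_point: "inj indicator_point"
  by (auto simp: inj_def indicator_point_def fun_eq_iff split: if_splits)

lemma mpoly_eval_indicator_point:
  assumes "multilinear f"
  shows "mpoly_eval f (indicator_point X) =
    (\<Sum>m\<in>Poly_Mapping.keys f. Poly_Mapping.lookup f m * of_bool (Poly_Mapping.keys m \<subseteq> X))"
  unfolding mpoly_eval_def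
proof (intro sum.cong refl arg_cong2[of _ _ _ _ "(*)"])
  fix m assume m: "m \<in> Poly_Mapping.keys f"
  have "(\<Prod>i\<in>Poly_Mapping.keys m. indicator_point X i ^ Poly_Mapping.lookup m i) =
      (\<Prod>i\<in>Poly_Mapping.keys m. indicator_point X i)"
  proof (intro prod.cong refl)
    fix i assume "i \<in> Poly_Mapping.keys m"
    hence "Poly_Mapping.lookup m i \<noteq> 0" by (simp add: in_keys_iff)
    moreover have "Poly_Mapping.lookup m i \<le> 1" using assms m by (auto simp: multilinear_def)
    ultimately have "Poly_Mapping.lookup m i = 1" by linarith
    thus "indicator_point X i ^ Poly_Mapping.lookup m i = indicator_point X i" by simp
  qed
  also have "\<dots> = of_bool (Poly_Mapping.keys m \<subseteq> X)"
    by (cases "Poly_Mapping.keys m \<subseteq> X") (auto simp: indicator_point_def intro!: prod.neutral)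
  finally show "(\<Prod>i\<in>Poly_Mapping.keys m. indicator_point X i ^ Poly_Mapping.lookup m i) =
     of_bool (Poly_Mapping.keys m \<subseteq> X)" .
qed

lemma monomial_degree_multilinear:
  assumes "multilinear f" "m \<in> Poly_Mapping.keys f"
  shows "monomial_degree m = card (Poly_Mapping.keys m)"
proof -
  have "monomial_degree m = (\<Sum>i\<in>Poly_Mapping.keys m. 1)"
    unfolding monomial_degree_def
  proof (intro sum.cong refl)
    fix i assume "i \<in> Poly_Mapping.keys m"
    hence "Poly_Mapping.lookup m i \<noteq> 0" by (simp add: in_keys_iff)
    moreover have "Poly_Mapping.lookup m i \<le> 1" using assms by (auto simp: multilinear_def)
    ultimately show "Poly_Mapping.lookup m i = 1" by linarith
  qed
  thus ?thesis by simp
qed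

lemma ex_harmonic_expansion:
  assumes "in_variables n f" "multilinear f" "total_degree f \<le> d"
  shows "\<exists>F. harmonic_expansion n d (\<lambda>X. mpoly_eval f (indicator_point X)) F"
proof -
  have "\<exists>F. harmonic_expansion n d (\<lambda>X. of_bool (Poly_Mapping.keys m \<subseteq> X)) F" if m: "m \<in> Poly_Mapping.keys f" for m
  proof -
    let ?A = "Poly_Mapping.keys m"
    have "card ?A \<le> total_degree f"
      unfolding monomial_degree_multilinear[OF assms(2) m, symmetric] total_degree_def using m by (intro Max_ge) auto
    hence "card ?A \<le> d" using assms by simp
    moreover have "homogeneous n (card ?A) (\<lambda>A. of_bool (A = ?A)) = (\<lambda>X. of_bool (?A \<subseteq> X))"
    proof
      fix X
      have "?A \<in> subsets_of_size n (card ?A)"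
        using assms(1) m by (auto simp: in_variables_def subsets_of_size_def)
      thus "homogeneous n (card ?A) (\<lambda>A. of_bool (A = ?A)) X = of_bool (?A \<subseteq> X)"
        unfolding homogeneous_def by (subst sum.remove[of _ ?A]) (auto intro!: sum.neutral)
    qed
    ultimately show ?thesis using homogeneous_expansion[of "card ?A" d n "\<lambda>A. of_bool (A = ?A)"] by simp
  qed
  then obtain F where F: "\<And>m. m \<in> Poly_Mapping.keys f \<Longrightarrow> harmonic_expansion n d (\<lambda>X. of_bool (Poly_Mapping.keys m \<subseteq> X)) (F m)"
    by metis
  show ?thesis
    unfolding mpoly_eval_indicator_point[OF assms(2)]
    using harmonic_expansion_sum[of "Poly_Mapping.keys f" n d "\<lambda>m X. of_bool (Poly_Mapping.keys m \<subseteq> X)" F, OF F] by blast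
qed

section \<open>Correlations along a random chain of slices\<close>

abbreviation perm_expectation :: "nat \<Rightarrow> ((nat \<Rightarrow> nat) \<Rightarrow> real) \<Rightarrow> real" where
  "perm_expectation n \<equiv> measure_pmf.expectation (pmf_of_set {\<pi>. \<pi> permutes {1..n}})"

lemma finite_permutations_nonempty:
  "finite {\<pi>. \<pi> permutes {1..n::nat}}" "{\<pi>. \<pi> permutes {1..n::nat}} \<noteq> {}"
proof -
  show "finite {\<pi>. \<pi> permutes {1..n::nat}}" by (simp add: finite_permutations)
  show "{\<pi>. \<pi> permutes {1..n::nat}} \<noteq> {}" using permutes_id by blast
qed

lemma expectation_permutations:
  "perm_expectation n F = (\<Sum>\<pi> | \<pi> permutes {1..n}. F \<pi>) / fact n"
proof -
  have "card {\<pi>. \<pi> permutes {1..n}} = fact n" by (rule card_permutations) auto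
  thus ?thesis using integral_pmf_of_set[OF finite_permutations_nonempty(2,1), where f = F]
    by (simp only: of_nat_fact)
qed

lemma perm_expectation_sum:
  "perm_expectation n (\<lambda>\<pi>. \<Sum>i\<in>I. a i * G i \<pi>) = (\<Sum>i\<in>I. a i * perm_expectation n (G i))"
  unfolding expectation_permutations
  by (subst sum.swap) (simp only: sum_distrib_left[symmetric] times_divide_eq_right sum_divide_distrib[of _ I])

lemma perm_expectation_mono:
  assumes "\<And>\<pi>. \<pi> permutes {1..n} \<Longrightarrow> G \<pi> \<le> H \<pi>"
  shows "perm_expectation n G \<le> perm_expectation n H"
  unfolding expectation_permutations
  using assms by (intro divide_right_mono sum_mono) auto

lemma permutes_prefix_subset:
  assumes "\<pi> permutes {1..n::nat}" "l \<le> n"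
  shows "\<pi> ` {1..l} \<subseteq> {1..n}"
proof -
  have "\<pi> ` {1..l} \<subseteq> \<pi> ` {1..n}" using assms(2) by (intro image_mono) auto
  thus ?thesis by (simp only: permutes_image[OF assms(1)])
qed

lemma permutes_prefix_card:
  assumes "\<pi> permutes {1..n::nat}"
  shows "card (\<pi> ` {1..l}) = l"
  using card_image[of \<pi> "{1..l}"] permutes_inj_on[OF assms] by simp

definition prefix_correlation :: "nat \<Rightarrow> (nat set \<Rightarrow> real) \<Rightarrow> nat \<Rightarrow> (nat set \<Rightarrow> real) \<Rightarrow> nat \<Rightarrow> real" where
  "prefix_correlation n g k h l =
     perm_expectation n (\<lambda>\<pi>. g (\<pi> ` {1..k}) * h (\<pi> ` {1..l}))"

lemma prefix_correlation_commute: "prefix_correlation n g k h l = prefix_correlation n h l g k"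
  by (simp add: prefix_correlation_def mult.commute)

text \<open>
  Composing \<open>\<pi>\<close> with a transposition shows that the point added to \<open>X\<^sub>l\<close> may be taken to be \<open>\<pi> m\<close>
  for any \<open>m > l\<close> without changing the correlation with \<open>X\<^sub>k\<close>. Averaging over \<open>m\<close> produces
  the upward average of \<open>h\<close>.
\<close>

lemma prefix_correlation_up:
  assumes h: "harmonic n j h" and kl: "k \<le> l" "l < n"
  shows "(real n - real l) * prefix_correlation n g k h (Suc l) =
         (real n - real l - real j) * prefix_correlation n g k h l"
proof -
  let ?P = "{\<pi>. \<pi> permutes {1..n}}"
  have "(\<Sum>\<pi>\<in>?P. g (\<pi> ` {1..k}) * h (\<pi> ` {1..Suc l})) =
        (\<Sum>\<pi>\<in>?P. g (\<pi> ` {1..k}) * h (insert (\<pi> m) (\<pi> ` {1..l})))"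
    if m: "m \<in> {Suc l..n}" for m
  proof -
    let ?t = "Transposition.transpose (Suc l) m"
    have t: "?t permutes {1..n}" using m kl by (intro permutes_swap_id) auto
    have im: "(\<pi> \<circ> ?t) ` {1..i} = \<pi> ` {1..i}" if "i \<le> l" for \<pi> :: "nat \<Rightarrow> nat" and i
      using that m by (intro image_cong) (auto simp: Transposition.transpose_def)
    have im2: "(\<pi> \<circ> ?t) ` {1..Suc l} = insert (\<pi> m) (\<pi> ` {1..l})" for \<pi> :: "nat \<Rightarrow> nat"
      using im[of l \<pi>] by (simp add: atLeastAtMostSuc_conv)
    show ?thesis
      by (subst sum_permutations_compose_right[OF t]) (simp only: im[OF kl(1)] im2)
  qed
  hence "(\<Sum>m\<in>{Suc l..n}. \<Sum>\<pi>\<in>?P. g (\<pi> ` {1..k}) * h (\<pi> ` {1..Suc l})) =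
        (\<Sum>m\<in>{Suc l..n}. \<Sum>\<pi>\<in>?P. g (\<pi> ` {1..k}) * h (insert (\<pi> m) (\<pi> ` {1..l})))"
    by (rule sum.cong[OF refl])
  also have "\<dots> = (\<Sum>\<pi>\<in>?P. g (\<pi> ` {1..k}) * (\<Sum>m\<in>{Suc l..n}. h (insert (\<pi> m) (\<pi> ` {1..l}))))"
    by (subst sum.swap) (simp add: sum_distrib_left)
  also have "\<dots> = (\<Sum>\<pi>\<in>?P. g (\<pi> ` {1..k}) * ((real n - real l - real j) * h (\<pi> ` {1..l})))"
  proof (intro sum.cong refl arg_cong2[of _ _ _ _ "(*)"])
    fix \<pi> assume "\<pi> \<in> ?P"
    hence \<pi>: "\<pi> permutes {1..n}" by simp
    have "{1..n} - \<pi> ` {1..l} = \<pi> ` ({1..n} - {1..l})"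
      by (simp only: image_set_diff[OF permutes_inj[OF \<pi>]] permutes_image[OF \<pi>])
    also have "{1..n} - {1..l} = {Suc l..n}" by auto
    finally have "(\<Sum>m\<in>{Suc l..n}. h (insert (\<pi> m) (\<pi> ` {1..l}))) =
        (\<Sum>i\<in>{1..n} - \<pi> ` {1..l}. h (insert i (\<pi> ` {1..l})))"
      by (simp add: sum.reindex[OF permutes_inj_on[OF \<pi>]])
    thus "(\<Sum>m\<in>{Suc l..n}. h (insert (\<pi> m) (\<pi> ` {1..l}))) = (real n - real l - real j) * h (\<pi> ` {1..l})"
      using h permutes_prefix_subset[OF \<pi>, of l] permutes_prefix_card[OF \<pi>, of l] kl
      by (simp add: harmonic_def)
  qed
  also have "\<dots> = (real n - real l - real j) * (\<Sum>\<pi>\<in>?P. g (\<pi> ` {1..k}) * h (\<pi> ` {1..l}))"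
    by (simp add: sum_distrib_left mult.left_commute)
  finally show ?thesis using kl
    unfolding prefix_correlation_def expectation_permutations by (simp add: field_simps)
qed

text \<open>
  The mirror image of the previous lemma: the point removed from \<open>X\<^sub>k\<^sub>+\<^sub>1\<close> may be any \<open>\<pi> m\<close> with
  \<open>m \<le> k + 1\<close>.
\<close>

lemma prefix_correlation_down:
  assumes g: "harmonic n j g" and kl: "k < l" "l \<le> n"
  shows "real (Suc k) * prefix_correlation n g k h l =
         (real (Suc k) - real j) * prefix_correlation n g (Suc k) h l"
proof -
  let ?P = "{\<pi>. \<pi> permutes {1..n}}"
  have "(\<Sum>\<pi>\<in>?P. g (\<pi> ` {1..k}) * h (\<pi> ` {1..l})) =
        (\<Sum>\<pi>\<in>?P. g (\<pi> ` {1..Suc k} - {\<pi> m}) * h (\<pi> ` {1..l}))"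
    if m: "m \<in> {1..Suc k}" for m
  proof -
    let ?t = "Transposition.transpose (Suc k) m"
    have t: "?t permutes {1..n}" using m kl by (intro permutes_swap_id) auto
    have im: "(\<pi> \<circ> ?t) ` {1..i} = \<pi> ` {1..i}" if "k < i" for \<pi> :: "nat \<Rightarrow> nat" and i
      using that m by (simp only: image_comp[symmetric]) (simp add: Transposition.transpose_image_eq)
    have im2: "(\<pi> \<circ> ?t) ` {1..k} = \<pi> ` {1..Suc k} - {\<pi> m}" if "\<pi> \<in> ?P" for \<pi> :: "nat \<Rightarrow> nat"
    proof -
      have inj: "inj (\<pi> \<circ> ?t)" using that t permutes_inj by (auto intro!: inj_compose)
      have "(\<pi> \<circ> ?t) ` ({1..Suc k} - {Suc k}) = (\<pi> \<circ> ?t) ` {1..Suc k} - {\<pi> m}"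
        by (subst image_set_diff[OF inj]) simp
      moreover have "{1..Suc k} - {Suc k} = {1..k}" by auto
      ultimately show ?thesis using im[of "Suc k" \<pi>] by simp
    qed
    show ?thesis
      by (subst sum_permutations_compose_right[OF t], intro sum.cong refl)
        (simp only: im[OF kl(1)] im2)
  qed
  hence "(\<Sum>m\<in>{1..Suc k}. \<Sum>\<pi>\<in>?P. g (\<pi> ` {1..k}) * h (\<pi> ` {1..l})) =
        (\<Sum>m\<in>{1..Suc k}. \<Sum>\<pi>\<in>?P. g (\<pi> ` {1..Suc k} - {\<pi> m}) * h (\<pi> ` {1..l}))"
    by (rule sum.cong[OF refl])
  also have "\<dots> = (\<Sum>\<pi>\<in>?P. (\<Sum>m\<in>{1..Suc k}. g (\<pi> ` {1..Suc k} - {\<pi> m})) * h (\<pi> ` {1..l}))"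
    by (subst sum.swap) (simp only: sum_distrib_right)
  also have "\<dots> = (\<Sum>\<pi>\<in>?P. ((real (Suc k) - real j) * g (\<pi> ` {1..Suc k})) * h (\<pi> ` {1..l}))"
  proof (intro sum.cong refl arg_cong2[of _ _ _ _ "(*)"])
    fix \<pi> assume "\<pi> \<in> ?P"
    hence \<pi>: "\<pi> permutes {1..n}" by simp
    have "(\<Sum>m\<in>{1..Suc k}. g (\<pi> ` {1..Suc k} - {\<pi> m})) =
        (\<Sum>i\<in>\<pi> ` {1..Suc k}. g (\<pi> ` {1..Suc k} - {i}))"
      by (simp add: sum.reindex[OF permutes_inj_on[OF \<pi>]])
    thus "(\<Sum>m\<in>{1..Suc k}. g (\<pi> ` {1..Suc k} - {\<pi> m})) = (real (Suc k) - real j) * g (\<pi> ` {1..Suc k})"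
      using g permutes_prefix_subset[OF \<pi>, of "Suc k"] permutes_prefix_card[OF \<pi>, of "Suc k"] kl
      by (simp add: harmonic_def)
  qed
  also have "\<dots> = (real (Suc k) - real j) * (\<Sum>\<pi>\<in>?P. g (\<pi> ` {1..Suc k}) * h (\<pi> ` {1..l}))"
    by (simp add: sum_distrib_left mult.assoc)
  finally show ?thesis
    unfolding prefix_correlation_def expectation_permutations by (simp add: field_simps)
qed

text \<open>
  Going up with one function and down with the other computes the same correlation between the
  slices \<open>m\<close> and \<open>m + 1\<close> in two ways. Exchanging the roles of \<open>g\<close> and \<open>h\<close> gives a second linear
  relation between the inner products on the two slices, and for \<open>i \<noteq> j\<close> the two relations are
  independent.
\<close>

lemma harmonic_orthogonal:
  assumes g: "harmonic n i g" and h: "harmonic n j h" and "i < j" "j \<le> m" "m + j < n"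
  shows "prefix_correlation n g m h m = 0"
proof -
  let ?T = "prefix_correlation n g m h m" and ?T' = "prefix_correlation n g (Suc m) h (Suc m)"
  let ?c = "prefix_correlation n"
  have 1: "(real n - real m) * ?c g m h (Suc m) = (real n - real m - real j) * ?T"
    using prefix_correlation_up[OF h, of m m] assms by simp
  have 2: "real (Suc m) * ?c g m h (Suc m) = (real (Suc m) - real i) * ?T'"
    using prefix_correlation_down[OF g, of m "Suc m"] assms by simp
  have 3: "(real n - real m) * ?c h m g (Suc m) = (real n - real m - real i) * ?T"
    using prefix_correlation_up[OF g, of m m h] assms by (simp add: prefix_correlation_commute)
  have 4: "real (Suc m) * ?c h m g (Suc m) = (real (Suc m) - real j) * ?T'"
    using prefix_correlation_down[OF h, of m "Suc m" g] assms by (simp add: prefix_correlation_commute)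
  define a b where "a = real n - real m" and "b = real (Suc m)"
  have A: "b * ((a - real j) * ?T) = a * ((b - real i) * ?T')"
    using 1 2 unfolding a_def b_def by (metis mult.left_commute)
  have B: "b * ((a - real i) * ?T) = a * ((b - real j) * ?T')"
    using 3 4 unfolding a_def b_def by (metis mult.left_commute)
  have "(b - real j) * (b * ((a - real j) * ?T)) = (b - real i) * (b * ((a - real i) * ?T))"
    unfolding A B by (simp add: algebra_simps)
  hence "b * ?T * ((b - real i) * (a - real i) - (b - real j) * (a - real j)) = 0"
    by (simp add: algebra_simps)
  moreover have "(b - real j) * (a - real j) < (b - real i) * (a - real i)"
    using assms by (intro mult_strict_mono) (auto simp: a_def b_def)
  moreover have "b > 0" by (simp add: b_def)
  ultimately show ?thesis by auto
qed

lemma prefix_correlation_up_prod: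
  assumes h: "harmonic n j h" and kl: "k \<le> l" "l \<le> n"
  shows "prefix_correlation n g k h l = (\<Prod>m\<in>{k..<l}. 1 - real j / (real n - real m)) * prefix_correlation n g k h k"
  using kl
proof (induction l rule: dec_induct)
  case base
  show ?case by simp
next
  case (step l)
  have "prefix_correlation n g k h (Suc l) = (1 - real j / (real n - real l)) * prefix_correlation n g k h l"
    using prefix_correlation_up[OF h, of k l g] step by (simp add: field_simps)
  thus ?case using step by (simp add: prod.atLeastLessThan_Suc)
qed

lemma prefix_correlation_down_prod:
  assumes g: "harmonic n j g" and kl: "k \<le> l" "l \<le> n"
  shows "prefix_correlation n g k h l = (\<Prod>m\<in>{k..<l}. 1 - real j / real (Suc m)) * prefix_correlation n g l h l"
  using kl
proof (induction k rule: inc_induct)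
  case base
  show ?case by simp
next
  case (step k)
  have "prefix_correlation n g k h l = (1 - real j / real (Suc k)) * prefix_correlation n g (Suc k) h l"
    using prefix_correlation_down[OF g, of k l h] step by (simp add: field_simps)
  thus ?case using step by (simp add: prod.atLeast_Suc_lessThan)
qed

lemma prod_one_minus_bounds:
  fixes x :: "'a \<Rightarrow> real"
  assumes "\<And>i. i \<in> I \<Longrightarrow> 0 \<le> x i" "\<And>i. i \<in> I \<Longrightarrow> x i \<le> c" "c \<le> 1"
  shows "1 - real (card I) * c \<le> (\<Prod>i\<in>I. 1 - x i)" "(\<Prod>i\<in>I. 1 - x i) \<le> 1"
proof -
  show "(\<Prod>i\<in>I. 1 - x i) \<le> 1"
    using assms by (intro prod_le_1) fastforce
  have "1 - real (card I) * c \<le> (1 - c) ^ card I"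
    using Bernoulli_inequality[of "- c" "card I"] assms(3) by simp
  also have "\<dots> \<le> (\<Prod>i\<in>I. 1 - x i)"
    using assms prod_mono[of I "\<lambda>_. 1 - c" "\<lambda>i. 1 - x i"] by simp
  finally show "1 - real (card I) * c \<le> (\<Prod>i\<in>I. 1 - x i)" .
qed

text \<open>
  With \<open>A\<close>, \<open>B\<close> the squared norms on the two slices, the correlation is both \<open>a A\<close> and \<open>b B\<close>, with
  factors \<open>a\<close>, \<open>b\<close> that are products of terms \<open>1 - j / m\<close> with \<open>m \<ge> R\<close>. The squared distance
  \<open>A + B - 2 b B\<close> is then \<open>B (1 + b / a - 2 b)\<close>.
\<close>

lemma harmonic_stable:
  assumes h: "harmonic n j h"
    and R: "R > 0" "real j \<le> R" "R \<le> real k" "R \<le> real l" "R \<le> real n - real k" "R \<le> real n - real l"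
    and \<theta>: "real j * \<bar>real k - real l\<bar> / R \<le> \<theta>" "\<theta> \<le> 1/2"
  shows "perm_expectation n (\<lambda>\<pi>. (h (\<pi> ` {1..k}) - h (\<pi> ` {1..l}))\<^sup>2)
     \<le> 3 * \<theta> * prefix_correlation n h l h l"
proof -
  let ?c = "prefix_correlation n"
  let ?E = "perm_expectation n"
  have diff: "?E (\<lambda>\<pi>. (h (\<pi> ` {1..k}) - h (\<pi> ` {1..l}))\<^sup>2) = ?c h k h k + ?c h l h l - 2 * ?c h k h l"
    unfolding prefix_correlation_def expectation_permutations
    by (simp add: power2_diff sum.distrib sum_subtractf
        sum_distrib_left add_divide_distrib diff_divide_distrib power2_eq_square mult.assoc left_diff_distrib right_diff_distrib del: One_nat_def)
  have pos: "?c h m h m \<ge> 0" for m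
    unfolding prefix_correlation_def expectation_permutations by (auto intro!: sum_nonneg divide_nonneg_nonneg)
  have key: "\<exists>a b. ?c h k h l = a * ?c h k h k \<and> ?c h k h l = b * ?c h l h l \<and>
      1 - \<theta> \<le> a \<and> a \<le> 1 \<and> 1 - \<theta> \<le> b \<and> b \<le> 1"
    if "k \<le> l" "R \<le> real k" "R \<le> real l" "R \<le> real n - real k" "R \<le> real n - real l"
      "real j * \<bar>real k - real l\<bar> / R \<le> \<theta>" for k l
  proof (intro exI conjI)
    have *: "real (card {k..<l}) * (real j / R) \<le> \<theta>" using that by (simp add: of_nat_diff mult.commute)
    have "l \<le> n" using that R by linarith
    show "?c h k h l = (\<Prod>m\<in>{k..<l}. 1 - real j / (real n - real m)) * ?c h k h k"
      by (rule prefix_correlation_up_prod[OF h that(1) \<open>l \<le> n\<close>])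
    show "?c h k h l = (\<Prod>m\<in>{k..<l}. 1 - real j / real (Suc m)) * ?c h l h l"
      by (rule prefix_correlation_down_prod[OF h that(1) \<open>l \<le> n\<close>])
    have j1: "real j / R \<le> 1" using R by simp
    have 1: "0 \<le> real j / (real n - real m)" "real j / (real n - real m) \<le> real j / R" if "m \<in> {k..<l}" for m
    proof -
      have "R \<le> real n - real m" using that \<open>R \<le> real n - real l\<close> by auto
      thus "0 \<le> real j / (real n - real m)" "real j / (real n - real m) \<le> real j / R"
        using R by (auto intro!: divide_left_mono divide_nonneg_nonneg mult_pos_pos)
    qed
    have 2: "0 \<le> real j / real (Suc m)" "real j / real (Suc m) \<le> real j / R" if "m \<in> {k..<l}" for m
    proof -
      have "R \<le> real (Suc m)" using that \<open>R \<le> real k\<close> by auto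
      thus "0 \<le> real j / real (Suc m)" "real j / real (Suc m) \<le> real j / R"
        using R by (auto intro!: divide_left_mono mult_pos_pos)
    qed
    note P1 = prod_one_minus_bounds[of "{k..<l}" "\<lambda>m. real j / (real n - real m)", OF 1 j1]
    note P2 = prod_one_minus_bounds[of "{k..<l}" "\<lambda>m. real j / real (Suc m)", OF 2 j1]
    show "1 - \<theta> \<le> (\<Prod>m\<in>{k..<l}. 1 - real j / (real n - real m))" using P1(1) * by linarith
    show "(\<Prod>m\<in>{k..<l}. 1 - real j / (real n - real m)) \<le> 1" by (rule P1(2))
    show "1 - \<theta> \<le> (\<Prod>m\<in>{k..<l}. 1 - real j / real (Suc m))" using P2(1) * by linarith
    show "(\<Prod>m\<in>{k..<l}. 1 - real j / real (Suc m)) \<le> 1" by (rule P2(2))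
  qed
  have ratio: "A + B - 2 * (b * B) \<le> 3 * \<theta> * B"
    if "a * A = b * B" "1 - \<theta> \<le> a" "a \<le> 1" "1 - \<theta> \<le> b" "b \<le> 1" "B \<ge> 0" for a b A B
  proof -
    have a: "a \<ge> 1/2" using that \<theta> by linarith
    have "1 + b / a - 2 * b \<le> 3 * \<theta>"
    proof -
      have "\<theta> \<ge> 0" using that by linarith
      have "b * (1 - a) / a \<le> 1 * \<theta> / (1/2)"
        using that a \<theta> \<open>\<theta> \<ge> 0\<close> by (intro frac_le mult_mono) auto
      hence "b * (1 - a) / a \<le> 2 * \<theta>" by simp
      moreover have "b / a - b = b * (1 - a) / a" using a by (simp add: field_simps)
      ultimately show ?thesis using that by linarith
    qed
    hence "B * (1 + b / a - 2 * b) \<le> B * (3 * \<theta>)" using that by (intro mult_left_mono) auto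
    moreover have "A = b * B / a" using that a by (simp add: field_simps)
    ultimately show ?thesis by (simp add: algebra_simps)
  qed
  show ?thesis
  proof (cases "k \<le> l")
    case True
    obtain a b where ab: "?c h k h l = a * ?c h k h k" "?c h k h l = b * ?c h l h l"
      "1 - \<theta> \<le> a" "a \<le> 1" "1 - \<theta> \<le> b" "b \<le> 1"
      using key[of k l] True R \<theta> by auto
    show ?thesis using ratio[of a "?c h k h k" b "?c h l h l"] ab pos diff by simp
  next
    case False
    obtain b a where ab: "?c h l h k = b * ?c h l h l" "?c h l h k = a * ?c h k h k"
      "1 - \<theta> \<le> a" "a \<le> 1" "1 - \<theta> \<le> b" "b \<le> 1"
      using key[of l k] False R \<theta> by (auto simp: abs_minus_commute)
    show ?thesis using ratio[of a "?c h k h k" b "?c h l h l"] ab pos diff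
      by (simp add: prefix_correlation_commute[of n h k h l])
  qed
qed

lemma harmonic_pythagoras:
  assumes harm: "\<And>j. j \<le> d \<Longrightarrow> harmonic n j (h j)" and "d \<le> m" "m + d < n"
  shows "prefix_correlation n (\<lambda>X. \<Sum>j\<le>d. h j X) m (\<lambda>X. \<Sum>j\<le>d. h j X) m = (\<Sum>j\<le>d. prefix_correlation n (h j) m (h j) m)"
proof -
  have orth: "prefix_correlation n (h i) m (h j) m = (if i = j then prefix_correlation n (h j) m (h j) m else 0)"
    if "i \<le> d" "j \<le> d" for i j
  proof (cases "i < j")
    case True
    thus ?thesis using harmonic_orthogonal[of n i "h i" j "h j" m] harm that assms by simp
  next
    case False
    thus ?thesis using harmonic_orthogonal[of n j "h j" i "h i" m] harm that assms
      by (cases "i = j") (auto simp: prefix_correlation_commute[of n "h i" m "h j"])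
  qed
  have "prefix_correlation n (\<lambda>X. \<Sum>j\<le>d. h j X) m (\<lambda>X. \<Sum>j\<le>d. h j X) m =
      perm_expectation n (\<lambda>\<pi>. \<Sum>i\<le>d. 1 * (\<Sum>j\<le>d. 1 * (h i (\<pi> ` {1..m}) * h j (\<pi> ` {1..m}))))"
    by (simp add: prefix_correlation_def sum_product)
  also have "\<dots> = (\<Sum>i\<le>d. \<Sum>j\<le>d. prefix_correlation n (h i) m (h j) m)"
    unfolding perm_expectation_sum by (simp add: prefix_correlation_def)
  also have "\<dots> = (\<Sum>i\<le>d. \<Sum>j\<le>d. if i = j then prefix_correlation n (h j) m (h j) m else 0)"
    by (intro sum.cong refl orth) auto
  also have "\<dots> = (\<Sum>j\<le>d. prefix_correlation n (h j) m (h j) m)"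
    by simp
  finally show ?thesis .
qed

section \<open>Interpolation between slices\<close>

definition lagrange_basis :: "'i set \<Rightarrow> ('i \<Rightarrow> real) \<Rightarrow> 'i \<Rightarrow> real \<Rightarrow> real" where
  "lagrange_basis I x i t = (\<Prod>j\<in>I - {i}. (t - x j) / (x i - x j))"

lemma lagrange_interpolation:
  assumes I: "finite I" and x: "inj_on x I" and q: "degree q < card I"
  shows "poly q t = (\<Sum>i\<in>I. lagrange_basis I x i t * poly q (x i))"
proof -
  define L where "L i = (\<Prod>j\<in>I - {i}. smult (1 / (x i - x j)) [:- x j, 1:])" for i
  have L: "poly (L i) t = lagrange_basis I x i t" for i t
    by (simp add: L_def lagrange_basis_def poly_prod diff_divide_distrib)
  have deg: "degree (L i) < card I" if "i \<in> I" for i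
  proof -
    have "degree (L i) \<le> sum (degree \<circ> (\<lambda>j. smult (1 / (x i - x j)) [:- x j, 1:])) (I - {i})"
      unfolding L_def by (rule degree_prod_sum_le) (use I in auto)
    also have "\<dots> \<le> (\<Sum>j\<in>I - {i}. 1)" by (intro sum_mono) (auto intro: order_trans[OF degree_smult_le])
    also have "\<dots> = card I - 1" using that I by simp
    also have "\<dots> < card I" using that I card_gt_0_iff[of I] by auto
    finally show ?thesis .
  qed
  define p where "p = (\<Sum>i\<in>I. smult (poly q (x i)) (L i))"
  have "q = p"
  proof (rule poly_eqI_degree)
    show "poly q y = poly p y" if "y \<in> x ` I" for y
    proof -
      obtain i where i: "i \<in> I" "y = x i" using \<open>y \<in> x ` I\<close> by blast
      have "lagrange_basis I x m (x i) = of_bool (m = i)" if "m \<in> I" for m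
      proof (cases "m = i")
        case True
        have "x i \<noteq> x j" if "j \<in> I - {i}" for j
        proof
          assume "x i = x j"
          hence "i = j" by (rule inj_onD[OF x]) (use that i in blast)+
          thus False using that by simp
        qed
        thus ?thesis using True by (auto simp: lagrange_basis_def intro!: prod.neutral)
      next
        case False
        thus ?thesis using I i by (auto simp: lagrange_basis_def)
      qed
      hence "poly p y = (\<Sum>m\<in>I. if m = i then poly q (x m) else 0)"
        unfolding p_def poly_sum i(2) by (intro sum.cong) (auto simp: L)
      thus ?thesis using I i by simp
    qed
    have c: "card (x ` I) = card I" using x by (rule card_image)
    show "degree q < card (x ` I)" using q c by simp
    have "degree p \<le> card I - 1"
      unfolding p_def using deg
      by (intro degree_sum_le I order_trans[OF degree_smult_le]) fastforce
    thus "degree p < card (x ` I)" using q c by simp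
  qed
  hence "poly q t = poly p t" by simp
  thus ?thesis by (simp add: p_def poly_sum L mult.commute)
qed

text \<open>
  If \<open>D\<^sub>i\<^sub>,\<^sub>j\<close> denotes the increment between the slices \<open>k\<^sub>i\<close> and \<open>l\<close> of the part of degree \<open>j\<close> of the
  harmonic function that agrees with \<open>\<phi>\<close> on the slice \<open>k\<^sub>i\<close>, then the error is
  \<open>\<Sum>\<^sub>i \<gamma>\<^sub>i \<Sum>\<^sub>j D\<^sub>i\<^sub>,\<^sub>j\<close>. Two applications of the Cauchy-Schwarz inequality cost \<open>(d + 1)\<^sup>2\<close>, and
  the sum over the nodes another \<open>d + 1\<close>; the sum over \<open>j\<close> costs nothing, by orthogonality.
\<close>

lemma interpolation_error:
  fixes k :: "'i \<Rightarrow> nat"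
  assumes F: "harmonic_expansion n d \<phi> F"
    and I: "finite I" "card I = d + 1" and inj: "inj_on k I"
    and norm: "\<And>i. i \<in> I \<Longrightarrow> prefix_correlation n \<phi> (k i) \<phi> (k i) \<le> 1"
    and R: "real d < R" "R \<le> real l" "R \<le> real n - real l"
      "\<And>i. i \<in> I \<Longrightarrow> R \<le> real (k i)" "\<And>i. i \<in> I \<Longrightarrow> R \<le> real n - real (k i)"
    and \<theta>: "\<And>i. i \<in> I \<Longrightarrow> real d * \<bar>real l - real (k i)\<bar> / R \<le> \<theta>" "0 \<le> \<theta>" "\<theta> \<le> 1/2"
    and \<gamma>: "\<And>i. i \<in> I \<Longrightarrow> \<gamma> i = lagrange_basis I (\<lambda>i. real (k i)) i (real l)"
    and G: "\<And>i. i \<in> I \<Longrightarrow> \<bar>\<gamma> i\<bar> \<le> G"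
  shows "perm_expectation n (\<lambda>\<pi>. (\<phi> (\<pi> ` {1..l}) - (\<Sum>i\<in>I. \<gamma> i * \<phi> (\<pi> ` {1..k i})))\<^sup>2)
     \<le> (real d + 1) ^ 3 * G\<^sup>2 * (3 * \<theta>)"
proof -
  have harm: "harmonic n j (F j t)" for j t using F by (simp add: harmonic_expansion_def)
  have exp: "\<phi> (\<pi> ` {1..m}) = (\<Sum>j\<le>d. F j (real m) (\<pi> ` {1..m}))" if "\<pi> permutes {1..n}" "m \<le> n" for \<pi> m
    using F permutes_prefix_subset[OF that] permutes_prefix_card[OF that(1), of m]
    by (simp add: harmonic_expansion_def)
  have ln: "l \<le> n" using R by linarith
  have kn: "k i \<le> n" if "i \<in> I" for i using R(5)[OF that] R(1) by linarith
  define D where "D i j \<pi> = F j (real (k i)) (\<pi> ` {1..l}) - F j (real (k i)) (\<pi> ` {1..k i})" for i j and \<pi> :: "nat \<Rightarrow> nat"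
  have interp: "F j (real l) X = (\<Sum>i\<in>I. \<gamma> i * F j (real (k i)) X)" for j X
  proof -
    obtain q where q: "degree q \<le> d" "\<And>t. F j t X = poly q t"
      using F unfolding harmonic_expansion_def by blast
    have "inj_on (\<lambda>i. real (k i)) I" using inj by (auto simp: inj_on_def)
    hence "poly q (real l) = (\<Sum>i\<in>I. lagrange_basis I (\<lambda>i. real (k i)) i (real l) * poly q (real (k i)))"
      using I q by (intro lagrange_interpolation) auto
    thus ?thesis using q \<gamma> by simp
  qed
  have pointwise: "(\<phi> (\<pi> ` {1..l}) - (\<Sum>i\<in>I. \<gamma> i * \<phi> (\<pi> ` {1..k i})))\<^sup>2 \<le>
      (\<Sum>i\<in>I. ((real d + 1)\<^sup>2 * G\<^sup>2) * (\<Sum>j\<le>d. 1 * (D i j \<pi>)\<^sup>2))" if \<pi>: "\<pi> permutes {1..n}" for \<pi>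
  proof -
    have "\<phi> (\<pi> ` {1..l}) = (\<Sum>i\<in>I. \<gamma> i * (\<Sum>j\<le>d. F j (real (k i)) (\<pi> ` {1..l})))"
      unfolding exp[OF \<pi> ln] interp by (subst sum.swap) (simp add: sum_distrib_left)
    moreover have "(\<Sum>i\<in>I. \<gamma> i * \<phi> (\<pi> ` {1..k i})) = (\<Sum>i\<in>I. \<gamma> i * (\<Sum>j\<le>d. F j (real (k i)) (\<pi> ` {1..k i})))"
      by (intro sum.cong refl) (simp only: exp[OF \<pi> kn])
    ultimately have "(\<phi> (\<pi> ` {1..l}) - (\<Sum>i\<in>I. \<gamma> i * \<phi> (\<pi> ` {1..k i})))\<^sup>2 = (\<Sum>i\<in>I. \<gamma> i * (\<Sum>j\<le>d. D i j \<pi>))\<^sup>2"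
      by (simp add: D_def sum_subtractf right_diff_distrib)
    also have "\<dots> \<le> (\<Sum>i\<in>I. (\<gamma> i * (\<Sum>j\<le>d. D i j \<pi>))\<^sup>2) * real (card I)"
      by (rule sum_squared_le_sum_of_squares)
    also have "\<dots> \<le> (\<Sum>i\<in>I. G\<^sup>2 * ((\<Sum>j\<le>d. (D i j \<pi>)\<^sup>2) * real (card {..d}))) * real (card I)"
    proof (intro mult_right_mono sum_mono)
      fix i assume i: "i \<in> I"
      have "\<bar>\<gamma> i\<bar>\<^sup>2 \<le> G\<^sup>2" using G[OF i] by (intro power_mono) auto
      thus "(\<gamma> i * (\<Sum>j\<le>d. D i j \<pi>))\<^sup>2 \<le> G\<^sup>2 * ((\<Sum>j\<le>d. (D i j \<pi>)\<^sup>2) * real (card {..d}))"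
        unfolding power_mult_distrib
        by (intro mult_mono sum_squared_le_sum_of_squares) auto
    qed auto
    also have "\<dots> = (\<Sum>i\<in>I. ((real d + 1)\<^sup>2 * G\<^sup>2) * (\<Sum>j\<le>d. 1 * (D i j \<pi>)\<^sup>2))"
      by (simp add: I(2) sum_distrib_left sum_distrib_right power2_eq_square mult_ac add_ac)
    finally show ?thesis .
  qed
  have level: "(\<Sum>j\<le>d. 1 * perm_expectation n (\<lambda>\<pi>. (D i j \<pi>)\<^sup>2)) \<le> 3 * \<theta>" if i: "i \<in> I" for i
  proof -
    have "(\<Sum>j\<le>d. 1 * perm_expectation n (\<lambda>\<pi>. (D i j \<pi>)\<^sup>2)) \<le>
        (\<Sum>j\<le>d. 3 * \<theta> * prefix_correlation n (F j (real (k i))) (k i) (F j (real (k i))) (k i))"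
    proof (rule sum_mono)
      fix j assume "j \<in> {..d}"
      hence "real j \<le> real d" by simp
      moreover have "real j * \<bar>real l - real (k i)\<bar> / R \<le> real d * \<bar>real l - real (k i)\<bar> / R"
        using \<open>real j \<le> real d\<close> R by (intro divide_right_mono mult_right_mono) auto
      ultimately show "1 * perm_expectation n (\<lambda>\<pi>. (D i j \<pi>)\<^sup>2) \<le>
          3 * \<theta> * prefix_correlation n (F j (real (k i))) (k i) (F j (real (k i))) (k i)"
        unfolding D_def mult_1
        using R \<theta>(1)[OF i] \<theta>(3) R(4,5)[OF i]
        by (intro harmonic_stable[OF harm, where R = R]) linarith+
    qed
    also have "\<dots> = 3 * \<theta> * prefix_correlation n (\<lambda>X. \<Sum>j\<le>d. F j (real (k i)) X) (k i) (\<lambda>X. \<Sum>j\<le>d. F j (real (k i)) X) (k i)"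
      using R(1) R(4,5)[OF i] by (subst harmonic_pythagoras) (auto simp: sum_distrib_left intro: harm)
    also have "prefix_correlation n (\<lambda>X. \<Sum>j\<le>d. F j (real (k i)) X) (k i) (\<lambda>X. \<Sum>j\<le>d. F j (real (k i)) X) (k i)
        = prefix_correlation n \<phi> (k i) \<phi> (k i)"
      unfolding prefix_correlation_def expectation_permutations
      by (intro arg_cong2[of _ _ _ _ "(/)"] sum.cong refl) (simp only: exp[OF _ kn[OF i]] mem_Collect_eq)
    also have "3 * \<theta> * \<dots> \<le> 3 * \<theta> * 1" using \<theta>(2) norm[OF i] by (intro mult_left_mono) auto
    finally show ?thesis by simp
  qed
  have "perm_expectation n (\<lambda>\<pi>. (\<phi> (\<pi> ` {1..l}) - (\<Sum>i\<in>I. \<gamma> i * \<phi> (\<pi> ` {1..k i})))\<^sup>2) \<le>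
      perm_expectation n (\<lambda>\<pi>. \<Sum>i\<in>I. ((real d + 1)\<^sup>2 * G\<^sup>2) * (\<Sum>j\<le>d. 1 * (D i j \<pi>)\<^sup>2))"
    by (rule perm_expectation_mono) (rule pointwise)
  also have "\<dots> = (\<Sum>i\<in>I. ((real d + 1)\<^sup>2 * G\<^sup>2) * (\<Sum>j\<le>d. 1 * perm_expectation n (\<lambda>\<pi>. (D i j \<pi>)\<^sup>2)))"
    by (simp only: perm_expectation_sum)
  also have "\<dots> \<le> (\<Sum>i\<in>I. ((real d + 1)\<^sup>2 * G\<^sup>2) * (3 * \<theta>))"
    by (intro sum_mono mult_left_mono level) auto
  also have "\<dots> = (real d + 1) ^ 3 * G\<^sup>2 * (3 * \<theta>)"
    by (simp add: I(2) power2_eq_square power3_eq_cube add_ac)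
  finally show ?thesis .
qed

text \<open>
  The nodes \<open>y\<close> and the point \<open>u\<close> are an affine image of \<open>x\<close> and \<open>t\<close>, which leaves the quotients of
  differences unchanged. The interpolation takes place in the weights of the slices, and the bound is
  in terms of their normalised deviations.
\<close>

lemma lagrange_basis_bound:
  fixes x :: "'i \<Rightarrow> real"
  assumes I: "finite I" "card I = d + 1" "i \<in> I" and "c \<noteq> 0" and \<eta>: "0 < \<eta>" "\<eta> \<le> 1" and M: "1 \<le> M"
    and sep: "\<And>j. j \<in> I \<Longrightarrow> j \<noteq> i \<Longrightarrow> \<eta> \<le> \<bar>x i - x j\<bar>"
    and bound: "\<And>j. j \<in> I \<Longrightarrow> \<bar>x j\<bar> \<le> M"
    and y: "\<And>j. j \<in> I \<Longrightarrow> u - y j = (t - x j) * c" "\<And>j. j \<in> I \<Longrightarrow> y i - y j = (x i - x j) * c"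
  shows "\<bar>lagrange_basis I y i u\<bar> \<le> ((1 + \<bar>t\<bar>) * (M / \<eta>)) ^ d"
proof -
  have "\<bar>lagrange_basis I y i u\<bar> = (\<Prod>j\<in>I - {i}. \<bar>(u - y j) / (y i - y j)\<bar>)"
    by (simp add: lagrange_basis_def abs_prod)
  also have "\<dots> \<le> (\<Prod>j\<in>I - {i}. (1 + \<bar>t\<bar>) * (M / \<eta>))"
  proof (intro prod_mono conjI)
    fix j assume j: "j \<in> I - {i}"
    have "(u - y j) / (y i - y j) = (t - x j) / (x i - x j)"
      using y[of j] j \<open>c \<noteq> 0\<close> by simp
    hence "\<bar>(u - y j) / (y i - y j)\<bar> = \<bar>t - x j\<bar> / \<bar>x i - x j\<bar>" by simp
    also have "\<dots> \<le> (\<bar>t\<bar> * M + M) / \<eta>"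
    proof (intro frac_le)
      have "\<bar>t\<bar> * 1 \<le> \<bar>t\<bar> * M" using M by (intro mult_left_mono) auto
      thus "\<bar>t - x j\<bar> \<le> \<bar>t\<bar> * M + M" using bound[of j] j by auto
    qed (use sep[of j] j \<eta> M in auto)
    finally show "\<bar>(u - y j) / (y i - y j)\<bar> \<le> (1 + \<bar>t\<bar>) * (M / \<eta>)"
      by (simp add: algebra_simps add_divide_distrib)
  qed auto
  also have "\<dots> = ((1 + \<bar>t\<bar>) * (M / \<eta>)) ^ d" using I by simp
  finally show ?thesis .
qed

section \<open>Slices and the product measure as images of random permutations\<close>

lemma pmf_eq_pmf_of_setI:
  assumes S: "finite S" "S \<noteq> {}" and sub: "set_pmf D \<subseteq> S" and const: "\<And>x y. x \<in> S \<Longrightarrow> y \<in> S \<Longrightarrow> pmf D x = pmf D y"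
  shows "D = pmf_of_set S"
proof (rule pmf_eqI)
  fix x
  show "pmf D x = pmf (pmf_of_set S) x"
  proof (cases "x \<in> S")
    case True
    have "1 = (\<Sum>y\<in>S. pmf D y)" using S sub by (simp add: sum_pmf_eq_1)
    also have "\<dots> = (\<Sum>y\<in>S. pmf D x)" using True by (intro sum.cong refl const)
    also have "\<dots> = real (card S) * pmf D x" by simp
    finally show ?thesis using True S by (simp add: field_simps)
  next
    case False
    thus ?thesis using S sub by (auto simp: set_pmf_iff)
  qed
qed

text \<open>
  A bijection between the two sets and one between their complements are glued together.
\<close>

lemma ex_permutes_image:
  assumes "finite N" "A \<subseteq> N" "B \<subseteq> N" "card A = card B"
  shows "\<exists>\<tau>. \<tau> permutes N \<and> \<tau> ` A = B"
proof -
  have fin: "finite A" "finite B" using assms finite_subset by auto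
  obtain f where f: "bij_betw f A B" using finite_same_card_bij[OF fin assms(4)] by blast
  have "card (N - A) = card (N - B)" using assms fin by (simp add: card_Diff_subset)
  then obtain g where g: "bij_betw g (N - A) (N - B)"
    using finite_same_card_bij[of "N - A" "N - B"] assms(1) by auto
  define \<tau> where "\<tau> x = (if x \<in> A then f x else if x \<in> N then g x else x)" for x
  have A: "bij_betw \<tau> A B" using f by (subst bij_betw_cong[of _ _ f]) (auto simp: \<tau>_def)
  have "bij_betw \<tau> (N - A) (N - B)" using g by (subst bij_betw_cong[of _ _ g]) (auto simp: \<tau>_def)
  hence "bij_betw \<tau> (A \<union> (N - A)) (B \<union> (N - B))" using A by (intro bij_betw_combine) auto
  moreover have "A \<union> (N - A) = N" "B \<union> (N - B) = N" using assms by auto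
  ultimately have "bij_betw \<tau> N N" by simp
  hence "\<tau> permutes N" using assms by (intro bij_imp_permutes) (auto simp: \<tau>_def)
  thus ?thesis using A bij_betw_imp_surj_on by blast
qed

text \<open>
  Left multiplication by a permutation preserves the uniform measure and moves any set of size \<open>k\<close> to any other.
\<close>

lemma map_prefix_uniform:
  assumes k: "k \<le> n"
  shows "map_pmf (\<lambda>\<pi>. \<pi> ` {1..k}) (pmf_of_set {\<pi>. \<pi> permutes {1..n}}) = pmf_of_set (subsets_of_size n k)"
proof (rule pmf_eq_pmf_of_setI)
  let ?P = "{\<pi>. \<pi> permutes {1..n}}"
  note fin = finite_permutations_nonempty[of n]
  show "subsets_of_size n k \<noteq> {}" using k by (auto simp: subsets_of_size_def intro!: exI[of _ "{1..k}"])
  show "set_pmf (map_pmf (\<lambda>\<pi>. \<pi> ` {1..k}) (pmf_of_set ?P)) \<subseteq> subsets_of_size n k"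
    unfolding set_map_pmf set_pmf_of_set[OF fin(2,1)] subsets_of_size_def
    by (rule image_subsetI) (simp only: mem_Collect_eq permutes_prefix_subset[OF _ k] permutes_prefix_card simp_thms)
  fix A B assume AB: "A \<in> subsets_of_size n k" "B \<in> subsets_of_size n k"
  obtain \<tau> where \<tau>: "\<tau> permutes {1..n}" "\<tau> ` A = B"
    using ex_permutes_image[of "{1..n}" A B] AB by (auto simp: subsets_of_size_def)
  have comp: "\<tau> \<circ> \<pi> permutes {1..n}" "inv \<tau> \<circ> \<pi> permutes {1..n}" if "\<pi> permutes {1..n}" for \<pi>
    using permutes_compose[OF that \<tau>(1)] permutes_compose[OF that permutes_inv[OF \<tau>(1)]] .
  have "bij_betw (\<lambda>\<pi>. \<tau> \<circ> \<pi>) ?P ?P"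
  proof (rule bij_betw_byWitness[where f' = "\<lambda>\<pi>. inv \<tau> \<circ> \<pi>"])
    show "\<forall>\<pi>\<in>?P. inv \<tau> \<circ> (\<tau> \<circ> \<pi>) = \<pi>" "\<forall>\<pi>\<in>?P. \<tau> \<circ> (inv \<tau> \<circ> \<pi>) = \<pi>"
      by (simp_all add: fun_eq_iff permutes_inverses[OF \<tau>(1)])
    show "(\<lambda>\<pi>. \<tau> \<circ> \<pi>) ` ?P \<subseteq> ?P" "(\<lambda>\<pi>. inv \<tau> \<circ> \<pi>) ` ?P \<subseteq> ?P"
      using comp by blast+
  qed
  hence "map_pmf (\<lambda>\<pi>. \<tau> \<circ> \<pi>) (pmf_of_set ?P) = pmf_of_set ?P"
    using fin by (simp add: map_pmf_of_set_bij_betw)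
  hence "map_pmf (\<lambda>\<pi>. \<pi> ` {1..k}) (pmf_of_set ?P) = map_pmf (\<lambda>\<pi>. \<pi> ` {1..k}) (map_pmf (\<lambda>\<pi>. \<tau> \<circ> \<pi>) (pmf_of_set ?P))"
    by (simp only:)
  also have "\<dots> = map_pmf (\<lambda>X. \<tau> ` X) (map_pmf (\<lambda>\<pi>. \<pi> ` {1..k}) (pmf_of_set ?P))"
    by (simp only: pmf.map_comp o_def image_image)
  finally have inv: "map_pmf (\<lambda>\<pi>. \<pi> ` {1..k}) (pmf_of_set ?P) = map_pmf (\<lambda>X. \<tau> ` X) (map_pmf (\<lambda>\<pi>. \<pi> ` {1..k}) (pmf_of_set ?P))" .
  have inj: "inj ((`) \<tau>)" by (rule injI) (simp only: inj_image_eq_iff[OF permutes_inj[OF \<tau>(1)]])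
  show "pmf (map_pmf (\<lambda>\<pi>. \<pi> ` {1..k}) (pmf_of_set ?P)) A = pmf (map_pmf (\<lambda>\<pi>. \<pi> ` {1..k}) (pmf_of_set ?P)) B"
    using pmf_map_inj'[OF inj, of "map_pmf (\<lambda>\<pi>. \<pi> ` {1..k}) (pmf_of_set ?P)" A]
    unfolding inv[symmetric] \<tau>(2) by (rule sym)
next
  show "finite (subsets_of_size n k)" by (rule finite_subsets_of_size)
qed

lemma sum_indicator_point:
  assumes "A \<subseteq> {1..n}"
  shows "(\<Sum>i=1..n. indicator_point A i) = real (card A)"
  using assms by (simp add: indicator_point_def sum.If_cases Int_absorb1)

lemma cube_imp_indicator_point:
  assumes "x \<in> cube n"
  obtains A where "A \<subseteq> {1..n}" "x = indicator_point A"
proof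
  have out: "x i = 0" if "i \<notin> {1..n}" for i
    using assms that unfolding cube_def PiE_dflt_def by blast
  have "x i = 0 \<or> x i = 1" for i
    using assms unfolding cube_def PiE_dflt_def by blast
  thus "x = indicator_point {i. x i = 1}" by (auto simp: indicator_point_def fun_eq_iff)
  show "{i. x i = 1} \<subseteq> {1..n}" using out by fastforce
qed

lemma slice_eq_image: "slice n k = indicator_point ` subsets_of_size n k"
proof (intro equalityI subsetI)
  fix x assume "x \<in> slice n k"
  hence x: "x \<in> cube n" "(\<Sum>i=1..n. x i) = real k" by (auto simp: slice_def)
  obtain A where "A \<subseteq> {1..n}" and xA: "x = indicator_point A"
    using cube_imp_indicator_point[OF x(1)] .
  moreover from this have "card A = k" using x(2) sum_indicator_point xA by simp
  ultimately show "x \<in> indicator_point ` subsets_of_size n k" using xA by (auto simp: subsets_of_size_def)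
next
  fix x assume "x \<in> indicator_point ` subsets_of_size n k"
  thus "x \<in> slice n k" using sum_indicator_point[of _ n]
    by (auto simp: subsets_of_size_def slice_def cube_def PiE_dflt_def) (auto simp: indicator_point_def)
qed

lemma card_slice: "card (slice n k) = n choose k"
  unfolding slice_eq_image
  by (simp add: card_image inj_on_subset[OF inj_indicator_point] card_subsets_of_size)

lemma nu_eq_map_permutations:
  assumes "k \<le> n"
  shows "nu n k = map_pmf (\<lambda>\<pi>. slice_point \<pi> k) (pmf_of_set {\<pi>. \<pi> permutes {1..n}})"
proof -
  have "subsets_of_size n k \<noteq> {}"
    using assms by (auto simp: subsets_of_size_def intro!: exI[of _ "{1..k}"])
  hence "nu n k = map_pmf indicator_point (pmf_of_set (subsets_of_size n k))"
    unfolding nu_def slice_eq_image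
    by (simp add: map_pmf_of_set_inj inj_on_subset[OF inj_indicator_point])
  thus ?thesis by (simp only: map_prefix_uniform[OF assms, symmetric] pmf.map_comp o_def slice_point_eq)
qed

lemma mu_eq_bind_nu:
  assumes p: "0 < p" "p < 1"
  shows "mu n p = bind_pmf (binomial_pmf n p) (nu n)"
proof (rule pmf_eqI)
  fix x
  have pmf_nu: "pmf (nu n k) x = (if x \<in> slice n k then 1 / real (n choose k) else 0)" if "k \<le> n" for k
  proof -
    have fin: "finite (slice n k)" unfolding slice_eq_image by (rule finite_imageI) simp
    have "n choose k \<noteq> 0" using that by (simp only: binomial_eq_0_iff not_less)
    hence ne: "slice n k \<noteq> {}" using card_slice[of n k] by fastforce
    show ?thesis unfolding nu_def pmf_of_set[OF ne fin] card_slice by (simp only: indicator_def) simp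
  qed
  have "pmf (bind_pmf (binomial_pmf n p) (nu n)) x =
      (\<Sum>k\<le>n. (real (n choose k) * p ^ k * (1 - p) ^ (n - k)) * pmf (nu n k) x)"
    unfolding pmf_bind using p by (subst expectation_binomial_pmf') auto
  also have "\<dots> = (\<Sum>k\<le>n. if x \<in> slice n k then p ^ k * (1 - p) ^ (n - k) else 0)"
    by (intro sum.cong) (auto simp: pmf_nu)
  also have "\<dots> = pmf (mu n p) x"
  proof (cases "x \<in> cube n")
    case False
    have "set_pmf (mu n p) \<subseteq> cube n"
      unfolding mu_def cube_def by (subst set_Pi_pmf) (auto simp: PiE_dflt_def of_bool_def)
    hence "pmf (mu n p) x = 0" using False by (auto simp: set_pmf_iff)
    thus ?thesis using False by (simp add: slice_def)
  next
    case True
    obtain A where AN: "A \<subseteq> {1..n}" and xA: "x = indicator_point A"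
      using cube_imp_indicator_point[OF True] .
    have cA: "card A \<le> n" using card_mono[OF _ AN] by simp
    have sx: "(\<Sum>i=1..n. x i) = real (card A)" unfolding xA by (rule sum_indicator_point[OF AN])
    hence sx': "(\<Sum>i=1..n. 1 - x i) = real (n - card A)" using cA by (simp add: sum_subtractf of_nat_diff)
    have "(\<Sum>k\<le>n. if x \<in> slice n k then p ^ k * (1 - p) ^ (n - k) else 0) =
        (\<Sum>k\<in>{card A}. p ^ k * (1 - p) ^ (n - k))"
      using True sx cA by (intro sum.mono_neutral_cong_right) (auto simp: slice_def)
    also have "\<dots> = pmf (mu n p) x"
      using pmf_mu[OF p True] p unfolding sx sx' by (simp add: powr_realpow)
    finally show ?thesis .
  qed
  finally show "pmf (mu n p) x = pmf (bind_pmf (binomial_pmf n p) (nu n)) x" ..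
qed

lemma mu_eq_map_pair:
  assumes p: "0 < p" "p < 1"
  shows "mu n p = map_pmf (\<lambda>(k, \<pi>). slice_point \<pi> k)
     (pair_pmf (binomial_pmf n p) (pmf_of_set {\<pi>. \<pi> permutes {1..n}}))"
proof -
  have "mu n p = bind_pmf (binomial_pmf n p) (\<lambda>k. map_pmf (\<lambda>\<pi>. slice_point \<pi> k) (pmf_of_set {\<pi>. \<pi> permutes {1..n}}))"
    unfolding mu_eq_bind_nu[OF p] using p by (intro bind_pmf_cong refl nu_eq_map_permutations) simp
  also have "\<dots> = map_pmf (\<lambda>(k, \<pi>). slice_point \<pi> k)
     (pair_pmf (binomial_pmf n p) (pmf_of_set {\<pi>. \<pi> permutes {1..n}}))"
    by (simp only: pair_pmf_def map_pmf_def bind_assoc_pmf bind_return_pmf prod.case)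
  finally show ?thesis .
qed

section \<open>The Levy distance to a conditioned mixture\<close>

text \<open>
  Boundedness from below of the set of admissible \<open>\<epsilon>\<close> is what makes the infimum meaningful; \<open>- 1\<close> is a
  crude bound that follows from \<open>0 \<le> cdf \<le> 1\<close>.
\<close>

lemma levy_distance_le:
  assumes "\<And>t. cdf X (t - \<epsilon>) - \<epsilon> \<le> cdf Y t" "\<And>t. cdf Y t \<le> cdf X (t + \<epsilon>) + \<epsilon>"
    and "prob_space X" "prob_space Y"
  shows "levy_distance X Y \<le> \<epsilon>"
  unfolding levy_distance_def
proof (rule cInf_lower)
  interpret X: prob_space X by fact
  interpret Y: prob_space Y by fact
  show "bdd_below {\<epsilon>. \<forall>t. cdf X (t - \<epsilon>) - \<epsilon> \<le> cdf Y t \<and> cdf Y t \<le> cdf X (t + \<epsilon>) + \<epsilon>}"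
  proof (rule bdd_belowI)
    fix \<delta> assume "\<delta> \<in> {\<epsilon>. \<forall>t. cdf X (t - \<epsilon>) - \<epsilon> \<le> cdf Y t \<and> cdf Y t \<le> cdf X (t + \<epsilon>) + \<epsilon>}"
    hence "cdf X (0 - \<delta>) - \<delta> \<le> cdf Y 0" by blast
    moreover have "cdf X (0 - \<delta>) \<ge> 0" "cdf Y 0 \<le> 1" by (simp_all add: cdf_def)
    ultimately show "- 1 \<le> \<delta>" by linarith
  qed
qed (use assms in auto)

lemma pmf_support_meets:
  assumes "measure_pmf.prob Q (- S) < 1"
  shows "set_pmf Q \<inter> S \<noteq> {}"
proof
  assume "set_pmf Q \<inter> S = {}"
  hence "set_pmf Q \<subseteq> - S" by auto
  hence "measure_pmf.prob Q (- S) = 1" by (simp add: measure_pmf.prob_eq_1 AE_measure_pmf_iff subset_eq)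
  thus False using assms by simp
qed

lemma measure_cond_pmf:
  assumes "set_pmf Q \<inter> S \<noteq> {}"
  shows "measure_pmf.prob (cond_pmf Q S) A = measure_pmf.prob Q (A \<inter> S) / measure_pmf.prob Q S"
  using emeasure_measure_pmf_not_zero[OF assms]
  by (simp add: cond_pmf.rep_eq[OF assms] Int_commute measure_pmf.emeasure_eq_measure)

text \<open>
  Conditioning on \<open>S\<close> removes the mass outside of \<open>S\<close> and redistributes the same amount inside, so
  no event gains or loses more than that.
\<close>

lemma cond_pmf_close:
  assumes "set_pmf Q \<inter> S \<noteq> {}"
  shows "\<bar>measure_pmf.prob (cond_pmf Q S) A - measure_pmf.prob Q A\<bar> \<le> measure_pmf.prob Q (- S)"
proof -
  define a s b where "a = measure_pmf.prob Q (A \<inter> S)" and "s = measure_pmf.prob Q S" and "b = measure_pmf.prob Q (A - S)"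
  have s0: "0 < s" using measure_measure_pmf_not_zero[OF assms] by (simp add: s_def zero_less_measure_iff)
  have s1: "s \<le> 1" by (simp add: s_def)
  have as: "0 \<le> a" "a \<le> s" by (auto simp: a_def s_def intro!: measure_pmf.finite_measure_mono)
  have ns: "measure_pmf.prob Q (- S) = 1 - s"
    using measure_pmf.prob_compl[of S Q] by (simp add: s_def Compl_eq_Diff_UNIV)
  have b: "0 \<le> b" "b \<le> 1 - s"
    unfolding ns[symmetric] by (auto simp: b_def intro!: measure_pmf.finite_measure_mono)
  have A: "measure_pmf.prob Q A = a + b"
    unfolding a_def b_def by (subst measure_pmf.finite_measure_Union[symmetric]) (auto intro!: arg_cong[where f = "measure_pmf.prob Q"])
  have "a / s - a = (a / s) * (1 - s)" using s0 by (simp add: field_simps)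
  also have "\<dots> \<le> 1 * (1 - s)" using s0 s1 as by (intro mult_right_mono) auto
  finally have "a / s - a \<le> 1 - s" by simp
  moreover have "a / s - a \<ge> 0" using s0 s1 as by (simp add: field_simps mult_left_le)
  ultimately show ?thesis
    using b unfolding measure_cond_pmf[OF assms] A ns a_def[symmetric] s_def[symmetric] by linarith
qed

text \<open>
  Half of \<open>\<epsilon>\<close> pays for conditioning, and the other half for the event \<open>\<bar>U - V\<bar> \<ge> \<epsilon>\<close>, whose
  probability is at most \<open>\<epsilon>\<^sup>3 / (2 \<epsilon>\<^sup>2)\<close> by Chebyshev's inequality. For \<open>\<epsilon> \<ge> 1\<close> the claim is trivial.
\<close>

lemma levy_distance_conditioned_le:
  fixes Q :: "'a pmf" and U V :: "'a \<Rightarrow> real"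
  assumes fin: "finite (set_pmf Q)" and \<epsilon>: "0 < \<epsilon>"
    and tail: "measure_pmf.prob Q (- S) \<le> \<epsilon> / 2"
    and L2: "set_pmf Q \<inter> S \<noteq> {} \<Longrightarrow> measure_pmf.expectation (cond_pmf Q S) (\<lambda>x. (U x - V x)\<^sup>2) \<le> \<epsilon> ^ 3 / 2"
  shows "levy_distance (measure_pmf (map_pmf U Q)) (measure_pmf (map_pmf V (cond_pmf Q S))) \<le> \<epsilon>"
proof -
  let ?P = "cond_pmf Q S"
  have cdfU: "cdf (measure_pmf (map_pmf U Q)) t = measure_pmf.prob Q {x. U x \<le> t}" for t
    by (simp add: cdf_def vimage_def)
  have cdfV: "cdf (measure_pmf (map_pmf V ?P)) t = measure_pmf.prob ?P {x. V x \<le> t}" for t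
    by (simp add: cdf_def vimage_def)
  have "measure_pmf.prob Q {x. U x \<le> t - \<epsilon>} - \<epsilon> \<le> measure_pmf.prob ?P {x. V x \<le> t} \<and>
      measure_pmf.prob ?P {x. V x \<le> t} \<le> measure_pmf.prob Q {x. U x \<le> t + \<epsilon>} + \<epsilon>" for t
  proof (cases "\<epsilon> < 1")
    case False
    have "measure_pmf.prob Q {x. U x \<le> t - \<epsilon>} \<le> 1" "measure_pmf.prob ?P {x. V x \<le> t} \<le> 1"
      "0 \<le> measure_pmf.prob Q {x. U x \<le> t + \<epsilon>}" "0 \<le> measure_pmf.prob ?P {x. V x \<le> t}" by auto
    thus ?thesis using False by linarith
  next
    case True
    have ne: "set_pmf Q \<inter> S \<noteq> {}"
      using tail True by (intro pmf_support_meets) linarith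
    have "finite (set_pmf ?P)" using fin by (simp add: set_cond_pmf[OF ne])
    hence "measure_pmf.prob ?P {x \<in> space (measure_pmf ?P). \<bar>U x - V x\<bar> \<ge> \<epsilon>} \<le>
        measure_pmf.expectation ?P (\<lambda>x. (U x - V x)\<^sup>2) / \<epsilon>\<^sup>2"
      using \<epsilon> by (intro measure_pmf.second_moment_method integrable_measure_pmf_finite) auto
    also have "\<dots> \<le> (\<epsilon> ^ 3 / 2) / \<epsilon>\<^sup>2" using L2[OF ne] by (intro divide_right_mono) auto
    also have "\<dots> = \<epsilon> / 2" using \<epsilon> by (simp add: power3_eq_cube power2_eq_square)
    finally have M: "measure_pmf.prob ?P {x. \<bar>U x - V x\<bar> \<ge> \<epsilon>} \<le> \<epsilon> / 2" by simp
    have un: "measure_pmf.prob ?P A \<le> measure_pmf.prob ?P B + measure_pmf.prob ?P C" if "A \<subseteq> B \<union> C" for A B C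
      using measure_pmf.finite_measure_mono[of "A" "B \<union> C" ?P] measure_Un_le[of B "measure_pmf ?P" C] that
      by simp
    have "measure_pmf.prob ?P {x. U x \<le> t - \<epsilon>} \<le> measure_pmf.prob ?P {x. V x \<le> t} + measure_pmf.prob ?P {x. \<bar>U x - V x\<bar> \<ge> \<epsilon>}"
      by (rule un) auto
    moreover have "measure_pmf.prob ?P {x. V x \<le> t} \<le> measure_pmf.prob ?P {x. U x \<le> t + \<epsilon>} + measure_pmf.prob ?P {x. \<bar>U x - V x\<bar> \<ge> \<epsilon>}"
      by (rule un) auto
    ultimately show ?thesis
      using M tail cond_pmf_close[OF ne, of "{x. U x \<le> t - \<epsilon>}"] cond_pmf_close[OF ne, of "{x. U x \<le> t + \<epsilon>}"]
      by linarith
  qed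
  thus ?thesis
    by (intro levy_distance_le measure_pmf.prob_space_axioms) (simp_all only: cdfU cdfV)
qed

lemma cond_pair_pmf:
  assumes "set_pmf B \<inter> S \<noteq> {}"
  shows "cond_pmf (pair_pmf B P) (fst -` S) = pair_pmf (cond_pmf B S) P"
proof (rule pmf_eqI)
  fix x :: "'a \<times> 'b"
  have ne: "set_pmf (pair_pmf B P) \<inter> fst -` S \<noteq> {}"
    using assms set_pmf_not_empty[of P] by fastforce
  have "measure_pmf.prob (pair_pmf B P) (fst -` S) = measure_pmf.prob B S"
    using measure_map_pmf[of fst "pair_pmf B P" S] by (simp add: map_fst_pair_pmf)
  thus "pmf (cond_pmf (pair_pmf B P) (fst -` S)) x = pmf (pair_pmf (cond_pmf B S) P) x"
    by (cases x) (simp add: pmf_cond[OF ne] pmf_cond[OF assms] pmf_pair)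
qed

lemma expectation_pair_pmf_le:
  fixes \<phi> :: "'a \<times> 'b \<Rightarrow> real"
  assumes "finite (set_pmf B)" "finite (set_pmf P)"
    and le: "\<And>x. x \<in> set_pmf B \<Longrightarrow> measure_pmf.expectation P (\<lambda>y. \<phi> (x, y)) \<le> c"
  shows "measure_pmf.expectation (pair_pmf B P) \<phi> \<le> c"
proof -
  have "measure_pmf.expectation (pair_pmf B P) \<phi> = (\<Sum>z\<in>set_pmf B \<times> set_pmf P. \<phi> z * pmf (pair_pmf B P) z)"
    using assms by (intro integral_measure_pmf_real) auto
  also have "\<dots> = (\<Sum>x\<in>set_pmf B. pmf B x * (\<Sum>y\<in>set_pmf P. \<phi> (x, y) * pmf P y))"
    by (simp add: sum.cartesian_product' pmf_pair sum_distrib_left mult.left_commute)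
  also have "\<dots> = (\<Sum>x\<in>set_pmf B. pmf B x * measure_pmf.expectation P (\<lambda>y. \<phi> (x, y)))"
    using assms by (intro sum.cong refl arg_cong2[of _ _ _ _ "(*)"] integral_measure_pmf_real[symmetric]) auto
  also have "\<dots> \<le> (\<Sum>x\<in>set_pmf B. pmf B x * c)"
    by (intro sum_mono mult_left_mono le) auto
  also have "\<dots> = c" using assms by (simp add: sum_distrib_right[symmetric] sum_pmf_eq_1)
  finally show ?thesis .
qed

text \<open>
  Both distributions are realised on the product of the binomial weight and the random permutation, the second
  one conditioned on the weight. There \<open>U\<close> and \<open>V\<close> read the same chain of slices, and they can be
  compared in \<open>L\<^sup>2\<close> for each weight separately.
\<close>

lemma levy_distance_slices_le:
  fixes p \<epsilon> :: real and k :: "nat \<Rightarrow> nat"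
  assumes p: "0 < p" "p < 1" and \<epsilon>: "0 < \<epsilon>"
    and window: "measure_pmf.prob (binomial_pmf n p) {l. \<not> \<bar>sigma_of p n l\<bar> \<le> s} < 1"
    and tail: "measure_pmf.prob (binomial_pmf n p) {l. \<not> \<bar>sigma_of p n l\<bar> \<le> s} \<le> \<epsilon> / 2"
    and L2: "\<And>l. l \<le> n \<Longrightarrow> \<bar>sigma_of p n l\<bar> \<le> s \<Longrightarrow>
      perm_expectation n (\<lambda>\<pi>. (mpoly_eval f (slice_point \<pi> l) - (\<Sum>i=1..r. \<gamma> l i * mpoly_eval f (slice_point \<pi> (k i))))\<^sup>2) \<le> \<epsilon> ^ 3 / 2"
  shows "levy_distance (measure_pmf (map_pmf (mpoly_eval f) (mu n p)))
     (measure_pmf (mixed_profile p n s \<gamma> r (profile n f r k))) \<le> \<epsilon>"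
proof -
  let ?P = "pmf_of_set {\<pi>. \<pi> permutes {1..n}}" and ?B = "binomial_pmf n p"
  define S where "S = {l. \<bar>sigma_of p n l\<bar> \<le> s}"
  define U where "U = (\<lambda>(l, \<pi>). mpoly_eval f (slice_point \<pi> l))"
  define V where "V = (\<lambda>(l, \<pi>). \<Sum>i=1..r. \<gamma> l i * mpoly_eval f (slice_point \<pi> (k i)))"
  have compl: "- S = {l. \<not> \<bar>sigma_of p n l\<bar> \<le> s}" by (auto simp: S_def)
  have neB: "set_pmf ?B \<inter> S \<noteq> {}" using window unfolding compl[symmetric] by (rule pmf_support_meets)
  have finB: "finite (set_pmf ?B)" using p by simp
  have finP: "finite (set_pmf ?P)"
    using finite_permutations_nonempty[of n] by simp
  have U: "map_pmf (mpoly_eval f) (mu n p) = map_pmf U (pair_pmf ?B ?P)"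
    unfolding mu_eq_map_pair[OF p] pmf.map_comp
    by (rule arg_cong[where f = "\<lambda>g. map_pmf g _"]) (simp add: U_def fun_eq_iff)
  have "mixed_profile p n s \<gamma> r (profile n f r k) = map_pmf V (pair_pmf (cond_pmf ?B S) ?P)"
    unfolding mixed_profile_def profile_def conditioned_binomial_def S_def[symmetric] pair_map_pmf2 pmf.map_comp
    by (intro map_pmf_cong) (auto simp: V_def)
  also have "pair_pmf (cond_pmf ?B S) ?P = cond_pmf (pair_pmf ?B ?P) (fst -` S)"
    by (rule cond_pair_pmf[OF neB, symmetric])
  finally have V: "mixed_profile p n s \<gamma> r (profile n f r k) = map_pmf V (cond_pmf (pair_pmf ?B ?P) (fst -` S))" .
  show ?thesis unfolding U V
  proof (rule levy_distance_conditioned_le)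
    show "finite (set_pmf (pair_pmf ?B ?P))" using finB finP by simp
    have "measure_pmf.prob (pair_pmf ?B ?P) (- (fst -` S)) = measure_pmf.prob ?B (- S)"
      using measure_map_pmf[of fst "pair_pmf ?B ?P" "- S"] by (simp add: map_fst_pair_pmf vimage_Compl)
    thus "measure_pmf.prob (pair_pmf ?B ?P) (- (fst -` S)) \<le> \<epsilon> / 2" by (simp only: compl tail)
    have "measure_pmf.expectation (pair_pmf (cond_pmf ?B S) ?P) (\<lambda>x. (U x - V x)\<^sup>2) \<le> \<epsilon> ^ 3 / 2"
    proof (rule expectation_pair_pmf_le)
      show "finite (set_pmf (cond_pmf ?B S))" using finB by (simp add: set_cond_pmf[OF neB])
      show "perm_expectation n (\<lambda>\<pi>. (U (l, \<pi>) - V (l, \<pi>))\<^sup>2) \<le> \<epsilon> ^ 3 / 2" if "l \<in> set_pmf (cond_pmf ?B S)" for l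
        using L2[of l] that p unfolding set_cond_pmf[OF neB] by (simp add: U_def V_def S_def)
    qed (rule finP)
    thus "measure_pmf.expectation (cond_pmf (pair_pmf ?B ?P) (fst -` S)) (\<lambda>x. (U x - V x)\<^sup>2) \<le> \<epsilon> ^ 3 / 2"
      by (simp only: cond_pair_pmf[OF neB])
  qed (rule \<epsilon>)
qed

section \<open>Concentration of the binomial distribution\<close>

lemma exp_le_quadratic:
  fixes x :: real
  assumes "\<bar>x\<bar> \<le> 1"
  shows "exp x \<le> 1 + x + x\<^sup>2"
proof (cases "x \<ge> 0")
  case True
  thus ?thesis using exp_bound[of x] assms by simp
next
  case False
  have "1 + x + x\<^sup>2 = (x + 1 / 2)\<^sup>2 + 3 / 4" by (simp add: power2_eq_square algebra_simps)
  moreover have "0 \<le> (x + 1 / 2)\<^sup>2" by simp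
  ultimately have pos: "1 + x + x\<^sup>2 > 0" by linarith
  have "x ^ 3 \<le> 0" using False by (simp add: power3_eq_cube mult_nonneg_nonpos)
  hence "1 \<le> (1 + x + x\<^sup>2) * (1 + (- x))"
    by (simp add: algebra_simps power2_eq_square power3_eq_cube)
  also have "\<dots> \<le> (1 + x + x\<^sup>2) * exp (- x)"
    using pos by (intro mult_left_mono exp_ge_add_one_self) auto
  finally show ?thesis by (simp add: exp_minus field_simps)
qed

text \<open>
  The quadratic bound on the exponential, applied to each Bernoulli factor, leaves the variance
  \<open>p (1 - p)\<close> in the exponent. A bound in terms of the range, as in Hoeffding's inequality, would be
  useless for small \<open>p (1 - p)\<close>.
\<close>

lemma binomial_mgf_le:
  fixes p \<theta> :: real
  assumes p: "0 < p" "p < 1" and \<theta>: "\<bar>\<theta>\<bar> \<le> 1"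
  shows "measure_pmf.expectation (binomial_pmf n p) (\<lambda>k. exp (\<theta> * (real k - real n * p))) \<le> exp (\<theta>\<^sup>2 * (real n * p * (1 - p)))"
proof -
  define q where "q = 1 - p"
  have "measure_pmf.expectation (binomial_pmf n p) (\<lambda>k. exp (\<theta> * (real k - real n * p))) =
      (\<Sum>k\<le>n. real (n choose k) * (p * exp (\<theta> * q)) ^ k * (q * exp (- \<theta> * p)) ^ (n - k))"
  proof (subst expectation_binomial_pmf', goal_cases)
    case 2
    show ?case
    proof (intro sum.cong refl)
      fix k assume "k \<in> {..n}"
      hence "\<theta> * (real k - real n * p) = real k * (\<theta> * q) + real (n - k) * (- \<theta> * p)"
        by (simp add: q_def of_nat_diff algebra_simps)
      hence "exp (\<theta> * (real k - real n * p)) = exp (\<theta> * q) ^ k * exp (- \<theta> * p) ^ (n - k)"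
        by (simp only: exp_add exp_of_nat_mult)
      thus "(real (n choose k) * p ^ k * (1 - p) ^ (n - k)) *\<^sub>R exp (\<theta> * (real k - real n * p)) =
          real (n choose k) * (p * exp (\<theta> * q)) ^ k * (q * exp (- \<theta> * p)) ^ (n - k)"
        by (simp add: q_def power_mult_distrib)
    qed
  qed (use p in auto)
  also have "\<dots> = (p * exp (\<theta> * q) + q * exp (- \<theta> * p)) ^ n"
    by (simp add: binomial_ring)
  also have "\<dots> \<le> (exp (\<theta>\<^sup>2 * (p * q))) ^ n"
  proof (rule power_mono)
    have "\<bar>\<theta> * q\<bar> \<le> 1" "\<bar>- \<theta> * p\<bar> \<le> 1"
      using p \<theta> by (auto simp: q_def abs_mult intro!: mult_le_one)
    hence "p * exp (\<theta> * q) + q * exp (- \<theta> * p) \<le> p * (1 + \<theta> * q + (\<theta> * q)\<^sup>2) + q * (1 + (- \<theta> * p) + (- \<theta> * p)\<^sup>2)"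
      using p by (intro add_mono mult_left_mono exp_le_quadratic) (auto simp: q_def)
    also have "\<dots> = 1 + \<theta>\<^sup>2 * (p * q)"
      by (simp add: q_def power2_eq_square algebra_simps)
    also have "\<dots> \<le> exp (\<theta>\<^sup>2 * (p * q))" by (rule exp_ge_add_one_self)
    finally show "p * exp (\<theta> * q) + q * exp (- \<theta> * p) \<le> exp (\<theta>\<^sup>2 * (p * q))" .
  qed (use p in \<open>auto simp: q_def intro!: add_nonneg_nonneg\<close>)
  also have "\<dots> = exp (\<theta>\<^sup>2 * (real n * p * (1 - p)))"
    by (simp add: q_def exp_of_nat_mult[symmetric] mult_ac)
  finally show ?thesis .
qed

text \<open>
  Chernoff's bound with parameter \<open>s / (2 \<surd>N)\<close> on both sides; the hypothesis on \<open>s\<close> keeps the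
  parameter in the range in which the bound on the moment generating function holds.
\<close>

lemma binomial_tail:
  fixes p s :: real
  assumes p: "0 < p" "p < 1" and s: "0 \<le> s" "s \<le> 2 * sqrt (real n * p * (1 - p))" and "n > 0"
  shows "measure_pmf.prob (binomial_pmf n p) {k. \<not> \<bar>sigma_of p n k\<bar> \<le> s} \<le> 2 * exp (- s\<^sup>2 / 4)"
proof -
  define N where "N = real n * p * (1 - p)"
  have N: "N > 0" using assms by (simp add: N_def)
  define \<theta> where "\<theta> = s / (2 * sqrt N)"
  have \<theta>: "0 \<le> \<theta>" "\<theta> \<le> 1" using s N by (auto simp: \<theta>_def N_def)
  let ?B = "binomial_pmf n p"
  have one: "measure_pmf.prob ?B {k. exp (\<theta>' * (real k - real n * p)) \<ge> exp (s\<^sup>2 / 2)} \<le> exp (- s\<^sup>2 / 4)"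
    if "\<bar>\<theta>'\<bar> = \<theta>" for \<theta>'
  proof -
    have sq: "\<theta>'\<^sup>2 * N = s\<^sup>2 / 4"
    proof -
      have "\<theta>'\<^sup>2 = \<theta>\<^sup>2" using that by (metis power2_abs)
      thus ?thesis using N by (simp add: \<theta>_def power_divide power_mult_distrib)
    qed
    have "measure_pmf.prob ?B {k \<in> space (measure_pmf ?B). exp (\<theta>' * (real k - real n * p)) \<ge> exp (s\<^sup>2 / 2)}
        \<le> measure_pmf.expectation ?B (\<lambda>k. exp (\<theta>' * (real k - real n * p))) / exp (s\<^sup>2 / 2)"
      using p by (intro integral_Markov_inequality_measure[where A = UNIV]) auto
    also have "\<dots> \<le> exp (s\<^sup>2 / 4) / exp (s\<^sup>2 / 2)"
      using binomial_mgf_le[OF p, of \<theta>' n] that \<theta>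
      unfolding N_def[symmetric] sq by (intro divide_right_mono) auto
    also have "\<dots> = exp (- s\<^sup>2 / 4)" by (simp add: exp_diff[symmetric])
    finally show ?thesis by simp
  qed
  have "{k. \<not> \<bar>sigma_of p n k\<bar> \<le> s} \<subseteq> {k. exp (\<theta> * (real k - real n * p)) \<ge> exp (s\<^sup>2 / 2)}
      \<union> {k. exp ((- \<theta>) * (real k - real n * p)) \<ge> exp (s\<^sup>2 / 2)}"
  proof
    fix k assume "k \<in> {k. \<not> \<bar>sigma_of p n k\<bar> \<le> s}"
    hence "s < \<bar>real k - real n * p\<bar> / sqrt N" using N by (simp add: sigma_of_def N_def abs_divide)
    hence "s * sqrt N \<le> \<bar>real k - real n * p\<bar>" using N by (simp add: field_simps)
    hence "\<theta> * (s * sqrt N) \<le> \<theta> * \<bar>real k - real n * p\<bar>" using \<theta> by (intro mult_left_mono)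
    moreover have "\<theta> * (s * sqrt N) = s\<^sup>2 / 2" using N by (simp add: \<theta>_def power2_eq_square)
    ultimately show "k \<in> {k. exp (\<theta> * (real k - real n * p)) \<ge> exp (s\<^sup>2 / 2)}
      \<union> {k. exp ((- \<theta>) * (real k - real n * p)) \<ge> exp (s\<^sup>2 / 2)}"
      by (cases "real k - real n * p \<ge> 0") (auto simp: algebra_simps)
  qed
  hence "measure_pmf.prob ?B {k. \<not> \<bar>sigma_of p n k\<bar> \<le> s} \<le>
     measure_pmf.prob ?B ({k. exp (\<theta> * (real k - real n * p)) \<ge> exp (s\<^sup>2 / 2)}
      \<union> {k. exp ((- \<theta>) * (real k - real n * p)) \<ge> exp (s\<^sup>2 / 2)})"
    by (intro measure_pmf.finite_measure_mono) auto
  also have "\<dots> \<le> exp (- s\<^sup>2 / 4) + exp (- s\<^sup>2 / 4)"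
    using \<theta> by (intro order_trans[OF measure_Un_le] add_mono one) auto
  finally show ?thesis by simp
qed

section \<open>Sizes of the parameters\<close>

lemma sigma_of_diff:
  assumes "real n * p * (1 - p) > 0"
  shows "real l - real k = (sigma_of p n l - sigma_of p n k) * sqrt (real n * p * (1 - p))"
proof -
  define c where "c = sqrt (real n * p * (1 - p))"
  have "c \<noteq> 0" using assms by (simp only: c_def real_sqrt_eq_zero_cancel_iff)
  hence "(a / c - b / c) * c = a - b" for a b :: real by (simp add: left_diff_distrib)
  thus ?thesis by (simp add: sigma_of_def c_def[symmetric])
qed

text \<open>
  Since \<open>N\<close> is at most \<open>n p\<close> and at most \<open>n (1 - p)\<close>, a weight within \<open>N / 9\<close> of \<open>n p\<close> is at
  distance at least \<open>N / 2\<close> from both \<open>0\<close> and \<open>n\<close>.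
\<close>

lemma central_level_margins:
  fixes p :: real
  assumes p: "0 < p" "p < 1" and N: "0 < real n * p * (1 - p)"
    and \<sigma>: "\<bar>sigma_of p n l\<bar> \<le> sqrt (real n * p * (1 - p)) / 9"
  shows "real n * p * (1 - p) / 2 \<le> real l" "real n * p * (1 - p) / 2 \<le> real n - real l"
proof -
  define N where "N = real n * p * (1 - p)"
  have N0: "N > 0" using N by (simp add: N_def)
  have "N \<le> real n * p * 1" "N \<le> real n * 1 * (1 - p)"
    unfolding N_def using p by (intro mult_left_mono mult_right_mono; simp)+
  hence le: "N \<le> real n * p" "N \<le> real n - real n * p" by (simp_all add: algebra_simps)
  have "\<bar>real l - real n * p\<bar> / sqrt N \<le> sqrt N / 9"
    using \<sigma> N0 by (simp add: sigma_of_def N_def abs_divide)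
  hence "\<bar>real l - real n * p\<bar> \<le> sqrt N / 9 * sqrt N" using N0 by (simp add: divide_le_eq)
  hence "\<bar>real l - real n * p\<bar> \<le> N / 9" using N0 by simp
  hence "N / 2 \<le> real l" "N / 2 \<le> real n - real l" using le N0 by linarith+
  thus "real n * p * (1 - p) / 2 \<le> real l" "real n * p * (1 - p) / 2 \<le> real n - real l"
    by (simp_all add: N_def)
qed

text \<open>
  With \<open>y = N\<^bsup>1/(24 d)\<^esup>\<close>, the inequality \<open>ln y\<^sup>2 \<le> y\<^sup>2\<close> gives \<open>s \<le> 36 d y\<close>, and \<open>y\<^bsup>3d\<^esup> = N\<^bsup>1/8\<^esup>\<close>.
\<close>

lemma log_power_absorbed:
  fixes N s :: real
  assumes N: "N > 1" and d: "1 \<le> d" and s: "s\<^sup>2 = 3 * ln N"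
  shows "s ^ (3 * d) \<le> (36 * real d) ^ (3 * d) * N powr (1 / 8)"
proof -
  define y where "y = N powr (1 / (24 * real d))"
  have y: "y > 0" using N by (simp add: y_def)
  have "ln N = 24 * real d * ln y" using N d by (simp add: y_def ln_powr)
  also have "\<dots> = 12 * real d * ln (y\<^sup>2)" using y by (simp add: ln_realpow)
  also have "\<dots> \<le> 12 * real d * y\<^sup>2"
    using y by (intro mult_left_mono ln_bound) auto
  finally have "s\<^sup>2 \<le> 36 * real d * y\<^sup>2" using s by simp
  also have "\<dots> \<le> (36 * real d)\<^sup>2 * y\<^sup>2" using d by (intro mult_right_mono) (auto simp: power2_eq_square)
  finally have "\<bar>s\<bar> \<le> \<bar>36 * real d * y\<bar>" by (simp add: abs_le_square_iff power_mult_distrib)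
  hence "\<bar>s\<bar> ^ (3 * d) \<le> (36 * real d * y) ^ (3 * d)" using y by (intro power_mono) auto
  moreover have "s ^ (3 * d) \<le> \<bar>s\<bar> ^ (3 * d)" by (simp add: power_abs[symmetric])
  moreover have "y ^ (3 * d) = N powr (1 / 8)"
    using y N d by (simp add: y_def powr_realpow[symmetric] powr_powr)
  ultimately show ?thesis by (simp add: power_mult_distrib)
qed

text \<open>
  The left-hand side is the bound on the squared \<open>L\<^sup>2\<close> error, with \<open>R\<close> for \<open>M / \<eta>\<close> and \<open>u\<close> for
  \<open>p (1 - p)\<close>, and the base on the right is the target distance. The comparison passes through \<open>b = 96 d R\<close>: the
  left-hand side is at most \<open>b\<^bsup>7d\<^esup> N\<^bsup>1/8 - 1/2\<^esup> / 2\<close>.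
\<close>

lemma error_absorbed:
  fixes N s R u :: real
  assumes N: "N > 1" and d: "1 \<le> d" and s: "1 \<le> s" "s\<^sup>2 = 3 * ln N" and R: "1 \<le> R" and u: "0 < u" "u \<le> 1"
  shows "48 * real d ^ 4 * (2 * s * R) ^ (3 * d) / sqrt N
    \<le> ((100 * (real d / u) * R) powr (100 * real d) * (1 / root 8 N)) ^ 3 / 2"
proof -
  define b where "b = 96 * real d * R"
  have dR: "1 \<le> real d * R" using d R mult_mono[of 1 "real d" 1 R] by simp
  have b: "1 \<le> b" using dR unfolding b_def by linarith
  have b': "96 * real d \<le> b" using mult_left_mono[OF R, of "96 * real d"] by (simp add: b_def)
  have "48 * real d ^ 4 \<le> (96 * real d) ^ 4 / 2" by (simp add: power_mult_distrib)
  also have "\<dots> \<le> b ^ 4 / 2" using b' by (intro divide_right_mono power_mono) auto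
  also have "\<dots> \<le> b ^ (4 * d) / 2" using b d by (intro divide_right_mono power_increasing) auto
  finally have 1: "48 * real d ^ 4 \<le> b ^ (4 * d) / 2" .
  have "(2 * s * R) ^ (3 * d) = (2 * R) ^ (3 * d) * s ^ (3 * d)" by (simp add: power_mult_distrib)
  also have "\<dots> \<le> (2 * R) ^ (3 * d) * ((36 * real d) ^ (3 * d) * N powr (1 / 8))"
    using R by (intro mult_left_mono log_power_absorbed N d s) auto
  also have "\<dots> = ((2 * R) * (36 * real d)) ^ (3 * d) * N powr (1 / 8)"
    by (simp only: power_mult_distrib mult.assoc)
  also have "\<dots> \<le> b ^ (3 * d) * N powr (1 / 8)"
    using R d by (intro mult_right_mono power_mono) (auto simp: b_def)
  finally have 2: "(2 * s * R) ^ (3 * d) \<le> b ^ (3 * d) * N powr (1 / 8)" .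
  have "48 * real d ^ 4 * (2 * s * R) ^ (3 * d) \<le> (b ^ (4 * d) / 2) * (b ^ (3 * d) * N powr (1 / 8))"
    using s R b by (intro mult_mono 1 2) auto
  hence "48 * real d ^ 4 * (2 * s * R) ^ (3 * d) / sqrt N \<le> (b ^ (4 * d) / 2) * (b ^ (3 * d) * N powr (1 / 8)) / sqrt N"
    using N by (intro divide_right_mono) auto
  also have "\<dots> = b ^ (7 * d) / 2 * (N powr (1 / 8) / N powr (1 / 2))"
  proof -
    have "b ^ (7 * d) = b ^ (4 * d) * b ^ (3 * d)" by (simp add: power_add[symmetric])
    thus ?thesis using N by (simp add: powr_half_sqrt)
  qed
  also have "N powr (1 / 8) / N powr (1 / 2) = N powr (- 3 / 8)"
    using N by (simp add: powr_diff[symmetric])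
  also have "b ^ (7 * d) / 2 * N powr (- 3 / 8) \<le> (100 * (real d / u) * R) powr (300 * real d) / 2 * N powr (- 3 / 8)"
  proof (intro mult_right_mono divide_right_mono)
    have "96 * real d * R \<le> 100 * (real d / u) * R"
    proof (rule mult_right_mono)
      have "real d \<le> real d / u" using u d by (simp add: le_divide_eq mult_left_le)
      thus "96 * real d \<le> 100 * (real d / u)" using d by linarith
    qed (use R in simp)
    hence le: "b \<le> 100 * (real d / u) * R" by (simp add: b_def)
    have "b ^ (7 * d) = b powr (7 * real d)" using b by (simp add: powr_realpow[symmetric])
    also have "\<dots> \<le> b powr (300 * real d)" using b d by (intro powr_mono) auto
    also have "\<dots> \<le> (100 * (real d / u) * R) powr (300 * real d)" using b le by (intro powr_mono2) auto
    finally show "b ^ (7 * d) \<le> (100 * (real d / u) * R) powr (300 * real d)" .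
  qed auto
  also have "\<dots> = ((100 * (real d / u) * R) powr (100 * real d) * (1 / root 8 N)) ^ 3 / 2"
  proof -
    have cube: "(x powr y) ^ 3 = x powr (3 * y)" for x y :: real
      by (simp add: power3_eq_cube powr_add[symmetric])
    have "((100 * (real d / u) * R) powr (100 * real d)) ^ 3 = (100 * (real d / u) * R) powr (300 * real d)"
      by (simp only: cube) simp
    moreover have "(1 / root 8 N) ^ 3 = N powr (- 3 / 8)"
    proof -
      have "1 / root 8 N = N powr (- 1 / 8)" using N by (simp add: root_powr_inverse powr_minus_divide)
      thus ?thesis by (simp only: cube) simp
    qed
    ultimately show ?thesis by (simp only: power_mult_distrib times_divide_eq_left)
  qed
  finally show ?thesis .
qed

lemma tail_absorbed:
  fixes N s R u :: real
  assumes N: "N > 1" and d: "1 \<le> d" and s: "s\<^sup>2 = 3 * ln N" and R: "1 \<le> R" and u: "0 < u" "u \<le> 1"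
  shows "2 * exp (- s\<^sup>2 / 4) \<le> ((100 * (real d / u) * R) powr (100 * real d) * (1 / root 8 N)) / 2"
proof -
  let ?a = "100 * (real d / u) * R"
  have "1 * 1 \<le> real d / u * R" using u d R by (intro mult_mono) (auto simp: field_simps)
  hence a: "?a \<ge> 100" by simp
  have grow: "x \<le> x powr (100 * real d)" if "x \<ge> 1" for x :: real
    using powr_mono[of 1 "100 * real d" x] that d by simp
  have A: "4 \<le> ?a powr (100 * real d)" using a grow[of ?a] by linarith
  have "2 * exp (- s\<^sup>2 / 4) = 2 * N powr (- 3 / 4)" using N s by (simp add: powr_def)
  also have "\<dots> \<le> 2 * N powr (- 1 / 8)" using N by (intro mult_left_mono powr_mono) auto
  also have "N powr (- 1 / 8) = 1 / root 8 N" using N by (simp add: root_powr_inverse powr_minus_divide)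
  also have "2 * (1 / root 8 N) \<le> ?a powr (100 * real d) / 2 * (1 / root 8 N)"
    using A N by (intro mult_right_mono) auto
  finally show ?thesis by simp
qed

text \<open>
  The two hypotheses that limit \<open>d\<close> and \<open>M\<close> force \<open>N \<ge> 81\<close> and keep the deviations \<open>s\<close> and \<open>M\<close> far
  below \<open>\<surd>N / d\<close>. The first one excludes \<open>N \<le> 1\<close>, where \<open>ln N \<le> 0\<close> makes its right-hand side
  nonpositive, by the conventions for division by \<open>0\<close> and for square roots of negative numbers.
\<close>

lemma parameter_bounds:
  fixes N M s :: real
  assumes N: "0 \<le> N" and d: "1 \<le> d" "real d \<le> 1 / 20 * sqrt (N / ln N)" and M: "1 \<le> M" "M \<le> sqrt N / (9 * real d)"
    and s: "s = sqrt (3 * ln N)"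
  shows "81 \<le> N" "s\<^sup>2 = 3 * ln N" "3 \<le> s" "real d * s \<le> sqrt N / 10" "real d * M \<le> sqrt N / 9"
proof -
  have "sqrt (N / ln N) \<ge> 20" using d by linarith
  hence "sqrt (N / ln N) > 0" by linarith
  hence "N / ln N > 0" by (simp only: real_sqrt_gt_0_iff)
  hence lN: "ln N > 0" and N0: "N > 0" using N by (auto simp: zero_less_divide_iff)
  have "9 * real d > 0" using d(1) by simp
  hence "M * (9 * real d) \<le> sqrt N" using M(2) by (simp only: pos_le_divide_eq)
  thus dM: "real d * M \<le> sqrt N / 9" by (simp add: mult_ac)
  have "1 * 1 \<le> real d * M" using M d by (intro mult_mono) auto
  hence "9 \<le> sqrt N" using dM by simp
  hence "9\<^sup>2 \<le> (sqrt N)\<^sup>2" by (intro power_mono) auto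
  thus N81: "81 \<le> N" using N0 by simp
  show s2: "s\<^sup>2 = 3 * ln N" using s lN by simp
  have "exp (4::real) = exp 1 ^ 4" using exp_of_nat_mult[of 4 "1::real"] by simp
  also have "\<dots> \<le> 3 ^ 4" by (intro power_mono exp_le) auto
  finally have "exp 4 \<le> N" using N81 by simp
  hence "4 \<le> ln N" using N0 by (simp add: ln_ge_iff)
  hence "3\<^sup>2 \<le> s\<^sup>2" using s2 by simp
  moreover have "0 \<le> s" using s lN by simp
  ultimately show "3 \<le> s" by (rule power2_le_imp_le)
  have "(real d)\<^sup>2 \<le> (1 / 20 * sqrt (N / ln N))\<^sup>2" using d by (intro power_mono) auto
  also have "\<dots> = N / ln N / 400" using lN N0 by (simp add: power_mult_distrib power_divide)
  finally have "(real d)\<^sup>2 * (3 * ln N) \<le> N * 3 / 400" using lN by (simp add: field_simps)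
  moreover have "(real d * s)\<^sup>2 = (real d)\<^sup>2 * (3 * ln N)" by (simp only: power_mult_distrib s2)
  moreover have "(sqrt N / 10)\<^sup>2 = N / 100" using N0 by (simp add: power_divide)
  ultimately have "(real d * s)\<^sup>2 \<le> (sqrt N / 10)\<^sup>2" using N0 by linarith
  thus "real d * s \<le> sqrt N / 10" by (rule power2_le_imp_le) (use N0 in simp)
qed

section \<open>The invariance principle for non-harmonic polynomials\<close>

theorem corollary6p18:
  shows "\<exists>K C :: real. K > 0 \<and> C > 0 \<and>
    (\<forall>(p::real) (n::nat) (d::nat) (k :: nat \<Rightarrow> nat) (\<eta>::real) (M::real) (s::real).
       0 < p \<and> p < 1 \<and>
       1 \<le> d \<and>
       real d \<le> K * sqrt (real n * p * (1 - p) / ln (real n * p * (1 - p))) \<and>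
       eta_M_system p n (d + 1) k \<eta> M \<and>
       M \<le> sqrt (real n * p * (1 - p)) / (9 * real d) \<and>
       s = sqrt (3 * ln (real n * p * (1 - p)))
       \<longrightarrow>
       (\<exists>\<gamma> :: nat \<Rightarrow> nat \<Rightarrow> real.
          (\<forall>l i. l \<le> n \<and> \<bar>sigma_of p n l\<bar> \<le> s \<and> i \<in> {1..d+1} \<longrightarrow>
             \<bar>\<gamma> l i\<bar> \<le> (C * (1 + \<bar>sigma_of p n l\<bar>) * (M / \<eta>)) ^ d) \<and>
          (\<forall>f :: real_mpoly.
             in_variables n f \<and> multilinear f \<and> total_degree f = d \<and>
             (\<forall>i\<in>{1..d+1}. L2_norm_under (nu n (k i)) f \<le> 1)
             \<longrightarrow>
             levy_distance
               (measure_pmf (map_pmf (mpoly_eval f) (mu n p)))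
               (measure_pmf (mixed_profile p n s \<gamma> (d + 1) (profile n f (d + 1) k)))
             \<le> (C * (real d / (p * (1 - p))) * (M / \<eta>)) powr (C * real d)
                * (1 / root 8 (real n * p * (1 - p))))))"
\<comment> \<open>With \<open>K = 1 / 20\<close> the window \<open>\<bar>\<sigma>(l)\<bar> \<le> s\<close> stays within \<open>\<surd>N / 10\<close> standard deviations, and
  \<open>d s \<le> \<surd>N / 10\<close>, \<open>d M \<le> \<surd>N / 9\<close> make the stability constant \<open>\<theta>\<close> below at most \<open>1 / 2\<close>.\<close>
proof (rule exI[of _ "1 / 20"], rule exI[of _ 100], intro conjI allI impI, goal_cases)
  case (3 p n d k \<eta> M s)
  define N where "N = real n * p * (1 - p)"
  from 3 have p: "0 < p" "p < 1" and d: "1 \<le> d" "real d \<le> 1 / 20 * sqrt (N / ln N)"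
    and sys: "eta_M_system p n (d + 1) k \<eta> M" and M_le: "M \<le> sqrt N / (9 * real d)" and s_eq: "s = sqrt (3 * ln N)"
    by (auto simp: N_def)
  have \<eta>: "0 < \<eta>" "\<eta> \<le> 1" and M: "1 \<le> M" and kn: "\<And>i. i \<in> {1..d+1} \<Longrightarrow> k i \<le> n"
    and sep: "\<And>i j. i \<in> {1..d+1} \<Longrightarrow> j \<in> {1..d+1} \<Longrightarrow> i \<noteq> j \<Longrightarrow> \<eta> \<le> \<bar>sigma_of p n (k i) - sigma_of p n (k j)\<bar>"
    and \<sigma>k: "\<And>i. i \<in> {1..d+1} \<Longrightarrow> \<bar>sigma_of p n (k i)\<bar> \<le> M"
    using sys unfolding eta_M_system_def by blast+
  have "0 \<le> N" using p by (simp add: N_def)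
  note params = parameter_bounds[OF this d M M_le s_eq]
  have N0: "0 < N" using params by simp
  have N0': "0 < real n * p * (1 - p)" using N0 by (simp add: N_def)
  have sqrt_pos: "0 < sqrt N" using N0 by simp
  have d0: "real d \<ge> 1" using d by simp
  define R where "R = M / \<eta>"
  have R: "1 \<le> R" "M \<le> R"
    using \<eta> M by (auto simp: R_def field_simps mult_left_le order_trans)
  have M9: "M \<le> sqrt N / 9"
    using params(5) mult_right_mono[of 1 "real d" M] d0 M by linarith
  have s10: "s \<le> sqrt N / 10"
    using params(4) mult_right_mono[of 1 "real d" s] d0 params(3) by linarith
  have diff: "real l - real m = (sigma_of p n l - sigma_of p n m) * sqrt N" for l m
    using sigma_of_diff[OF N0'] by (simp add: N_def)
  define \<gamma> where "\<gamma> l i = lagrange_basis {1..d+1} (\<lambda>i. real (k i)) i (real l)" for l i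
  have \<gamma>: "\<bar>\<gamma> l i\<bar> \<le> ((1 + \<bar>sigma_of p n l\<bar>) * R) ^ d" if i: "i \<in> {1..d+1}" for l i
    unfolding \<gamma>_def R_def
  proof (rule lagrange_basis_bound[where c = "sqrt N" and x = "\<lambda>i. sigma_of p n (k i)"])
    show "sqrt N \<noteq> 0" using N0 by simp
  qed (use i \<eta> M sep \<sigma>k diff in auto)
  show ?case
  proof (rule exI[of _ \<gamma>], intro conjI allI impI, goal_cases)
    case (1 l i)
    have "(1 + \<bar>sigma_of p n l\<bar>) * R \<le> 100 * ((1 + \<bar>sigma_of p n l\<bar>) * R)" using R by simp
    hence "((1 + \<bar>sigma_of p n l\<bar>) * R) ^ d \<le> (100 * ((1 + \<bar>sigma_of p n l\<bar>) * R)) ^ d"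
      using R by (intro power_mono) auto
    moreover have "\<bar>\<gamma> l i\<bar> \<le> ((1 + \<bar>sigma_of p n l\<bar>) * R) ^ d" using 1 by (intro \<gamma>) simp
    ultimately have "\<bar>\<gamma> l i\<bar> \<le> (100 * ((1 + \<bar>sigma_of p n l\<bar>) * R)) ^ d" by linarith
    thus ?case by (simp only: R_def mult.assoc)
  next
    case (2 f)
    hence f: "in_variables n f" "multilinear f" "total_degree f \<le> d"
      and norm: "\<And>i. i \<in> {1..d+1} \<Longrightarrow> L2_norm_under (nu n (k i)) f \<le> 1" by auto
    define u where "u = p * (1 - p)"
    have u: "0 < u" "u \<le> 1" using p by (auto simp: u_def intro: mult_le_one)
    define \<phi> where "\<phi> X = mpoly_eval f (indicator_point X)" for X
    obtain F where F: "harmonic_expansion n d \<phi> F"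
      using ex_harmonic_expansion[OF f] unfolding \<phi>_def by blast
    define \<epsilon> where "\<epsilon> = (100 * (real d / u) * R) powr (100 * real d) * (1 / root 8 N)"
    have \<epsilon>: "\<epsilon> > 0" using N0 u R d0 by (simp add: \<epsilon>_def)
    have tail: "measure_pmf.prob (binomial_pmf n p) {l. \<not> \<bar>sigma_of p n l\<bar> \<le> s} \<le> 2 * exp (- s\<^sup>2 / 4)"
    proof (rule binomial_tail[OF p])
      show "s \<le> 2 * sqrt (real n * p * (1 - p))" using s10 sqrt_pos unfolding N_def[symmetric] by linarith
      show "0 < n" using N0' by (cases n) auto
    qed (use params in simp)
    have "levy_distance (measure_pmf (map_pmf (mpoly_eval f) (mu n p)))
        (measure_pmf (mixed_profile p n s \<gamma> (d + 1) (profile n f (d + 1) k))) \<le> \<epsilon>"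
    proof (rule levy_distance_slices_le[OF p \<epsilon>])
      show "measure_pmf.prob (binomial_pmf n p) {l. \<not> \<bar>sigma_of p n l\<bar> \<le> s} \<le> \<epsilon> / 2"
        using tail tail_absorbed[of N d s R u] params d R u unfolding \<epsilon>_def by simp
      have "3\<^sup>2 \<le> s\<^sup>2" using params(3) by (intro power_mono) auto
      hence "exp (- s\<^sup>2 / 4) \<le> exp (- 2)" by simp
      also have "exp (- 2) \<le> (1 / 3 :: real)"
        using exp_ge_add_one_self[of "2::real"] le_imp_inverse_le[of 3 "exp (2::real)"] by (simp add: exp_minus)
      finally show "measure_pmf.prob (binomial_pmf n p) {l. \<not> \<bar>sigma_of p n l\<bar> \<le> s} < 1"
        using tail by linarith
      fix l assume l: "l \<le> n" "\<bar>sigma_of p n l\<bar> \<le> s"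
      define G where "G = ((1 + s) * R) ^ d"
      \<comment> \<open>The weights \<open>l\<close> and \<open>k i\<close> differ by at most \<open>(s + M) \<surd>N\<close>, and \<open>\<theta>\<close> is \<open>d\<close> times
        this distance, relative to the distance \<open>N / 2\<close> from the extreme slices.\<close>
      define \<theta> where "\<theta> = 2 * real d * (s + M) / sqrt N"
      have "perm_expectation n (\<lambda>\<pi>. (\<phi> (\<pi> ` {1..l}) - (\<Sum>i\<in>{1..d+1}. \<gamma> l i * \<phi> (\<pi> ` {1..k i})))\<^sup>2)
          \<le> (real d + 1) ^ 3 * G\<^sup>2 * (3 * \<theta>)"
      proof (rule interpolation_error[OF F, where R = "N / 2"])
        show "inj_on k {1..d+1}"
        proof (rule inj_onI, rule ccontr)
          fix i j assume "i \<in> {1..d+1}" "j \<in> {1..d+1}" "k i = k j" "i \<noteq> j"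
          thus False using sep[of i j] \<eta> by simp
        qed
        show "prefix_correlation n \<phi> (k i) \<phi> (k i) \<le> 1" if "i \<in> {1..d+1}" for i
          using norm[OF that] unfolding L2_norm_under_def nu_eq_map_permutations[OF kn[OF that]]
          by (simp add: prefix_correlation_def \<phi>_def slice_point_eq power2_eq_square)
        show "real d < N / 2"
        proof -
          have "real d \<le> sqrt N / 9" using params(5) mult_left_mono[of 1 M "real d"] M by linarith
          moreover have "sqrt N \<le> N" using params(1) by (simp add: real_le_lsqrt real_sqrt_le_iff sqrt_le_D power2_eq_square)
          ultimately show ?thesis using N0 by linarith
        qed
        show "N / 2 \<le> real l" "N / 2 \<le> real n - real l"
          using central_level_margins[OF p N0', of l] l s10 params(3) unfolding N_def[symmetric] by auto
        show "N / 2 \<le> real (k i)" "N / 2 \<le> real n - real (k i)" if "i \<in> {1..d+1}" for i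
          using central_level_margins[OF p N0', of "k i"] \<sigma>k[OF that] M9 unfolding N_def[symmetric] by auto
        show "real d * \<bar>real l - real (k i)\<bar> / (N / 2) \<le> \<theta>" if "i \<in> {1..d+1}" for i
        proof -
          have "\<bar>real l - real (k i)\<bar> \<le> (s + M) * sqrt N"
            unfolding diff abs_mult using l \<sigma>k[OF that] N0 by (intro mult_mono) auto
          hence "real d * \<bar>real l - real (k i)\<bar> / (N / 2) \<le> real d * ((s + M) * sqrt N) / (N / 2)"
            using N0 by (intro divide_right_mono mult_left_mono) auto
          also have "\<dots> = 2 * real d * (s + M) * (sqrt N / N)" by simp
          also have "sqrt N / N = 1 / sqrt N"
            using N0 by (simp add: sqrt_divide_self_eq inverse_eq_divide)
          also have "2 * real d * (s + M) * (1 / sqrt N) = \<theta>" by (simp add: \<theta>_def)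
          finally show ?thesis .
        qed
        show "0 \<le> \<theta>" using params(3) M N0 by (simp add: \<theta>_def)
        have "real d * (s + M) \<le> sqrt N / 10 + sqrt N / 9" using params(4,5) by (simp add: algebra_simps)
        hence "2 * (real d * (s + M)) \<le> 1 / 2 * sqrt N" using sqrt_pos by linarith
        thus "\<theta> \<le> 1 / 2" using N0 by (simp add: \<theta>_def divide_le_eq mult.assoc)
        show "\<bar>\<gamma> l i\<bar> \<le> G" if "i \<in> {1..d+1}" for i
        proof -
          have "((1 + \<bar>sigma_of p n l\<bar>) * R) ^ d \<le> G"
            unfolding G_def using R l by (intro power_mono mult_right_mono) auto
          thus ?thesis using \<gamma>[OF that, of l] by linarith
        qed
      qed (auto simp: \<gamma>_def)
      also have "\<dots> \<le> (2 * real d) ^ 3 * G\<^sup>2 * (3 * (2 * real d * ((1 + s) * R) / sqrt N))"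
      proof (intro mult_mono)
        have "s + M \<le> (1 + s) * R"
        proof -
          have "s * 1 \<le> s * R" using R params(3) by (intro mult_left_mono) auto
          thus ?thesis using R by (simp add: algebra_simps)
        qed
        thus "\<theta> \<le> 2 * real d * ((1 + s) * R) / sqrt N"
          unfolding \<theta>_def using N0 by (intro divide_right_mono mult_left_mono) auto
        show "(real d + 1) ^ 3 \<le> (2 * real d) ^ 3" using d0 by (intro power_mono) auto
      qed (use d0 M params(3) N0 in \<open>auto simp: \<theta>_def\<close>)
      also have "\<dots> = 48 * real d ^ 4 * ((1 + s) * R) ^ (2 * d + 1) / sqrt N"
        by (simp add: G_def power_mult[symmetric] power_add eval_nat_numeral mult_ac)
      also have "\<dots> \<le> 48 * real d ^ 4 * (2 * s * R) ^ (3 * d) / sqrt N"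
      proof (intro divide_right_mono mult_left_mono)
        have 1: "1 \<le> 2 * s * R" using mult_mono[of 1 "2 * s" 1 R] R params(3) by simp
        have "((1 + s) * R) ^ (2 * d + 1) \<le> (2 * s * R) ^ (2 * d + 1)"
          using R params(3) by (intro power_mono mult_right_mono) auto
        also have "\<dots> \<le> (2 * s * R) ^ (3 * d)" using 1 d by (intro power_increasing) auto
        finally show "((1 + s) * R) ^ (2 * d + 1) \<le> (2 * s * R) ^ (3 * d)" .
      qed (use N0 in auto)
      also have "\<dots> \<le> \<epsilon> ^ 3 / 2"
        unfolding \<epsilon>_def using params d R u by (intro error_absorbed) auto
      finally show "perm_expectation n (\<lambda>\<pi>. (mpoly_eval f (slice_point \<pi> l) - (\<Sum>i=1..d+1. \<gamma> l i * mpoly_eval f (slice_point \<pi> (k i))))\<^sup>2) \<le> \<epsilon> ^ 3 / 2"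
        by (simp only: \<phi>_def slice_point_eq)
    qed
    thus ?case by (simp only: \<epsilon>_def u_def R_def N_def)
  qed
qed simp_all

end
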